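(* Let $\kappa$ be a strongly compact cardinal and let $\mathbf{K}$ be an abstract elementary class with $\mathrm{LS}(\mathbf{K})<\kappa$. (i) If $\mathbf{K}$ satisfies $AP(<\kappa)$, then $\mathbf{K}$ satisfies AP. (ii) If $\mathbf{K}$ satisfies $JEP(<\kappa)$, then $\mathbf{K}$ satisfies JEP. (iii) If $\mathbf{K}$ satisfies $DAP(<\kappa)$, then $\mathbf{K}$ satisfies DAP.
   Context: $\mathbf{K}=(\mathbf{K},\prec_{\mathbf{K}})$ is an abstract elementary class with Löwenheim–Skolem number $\mathrm{LS}(\mathbf{K})$; a $\mathbf{K}$-embedding is an isomorphism onto a strong substructure. $\mathbf{K}_{<\kappa}$ denotes the models of $\mathbf{K}$ of cardinality in $[\mathrm{LS}(\mathbf{K}),\kappa)$. - AP (resp. $AP(<\kappa)$): for all $M_0\prec_{\mathbf{K}}M_1,M_2$ from $\mathbf{K}$ (resp. from $\mathbf{K}_{<\kappa}$) there are $N\in\mathbf{K}$ and $\mathbf{K}$-embeddings $f_\ell:M_\ell\to N$ ($\ell=1,2$) agreeing on $M_0$. - DAP (resp. $DAP(<\kappa)$): as AP (resp. $AP(<\kappa)$) with additionally $f_1(M_1)\cap f_2(M_2)=f_1(M_0)$. - JEP (resp. $JEP(<\kappa)$): any two models from $\mathbf{K}$ (resp. $\mathbf{K}_{<\kappa}$) $\mathbf{K}$-embed into a common model of $\mathbf{K}$. A cardinal $\kappa$ is strongly compact iff every $\kappa$-complete filter on any set extends to a $\kappa$-complete ultrafilter.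
   Formalization: Adds the usual convention that every model of K has cardinality at least LS(K) (with LS(K) infinite); without it the claim fails, e.g. for a class with only finite models, where K_{<κ} is empty and AP(<κ), JEP(<κ), DAP(<κ) hold vacuously while AP, JEP, DAP fail. *)

theory Defs
  imports Complex_Main "HOL-Library.FuncSet"
begin

unbundle cardinal_syntax

section \<open>First-order structures\<close>

text \<open>Constants are function symbols of arity 0.\<close>

record ('f, 'r) vocabulary =
  Funs :: "'f set"
  Rels :: "'r set"
  fun_arity :: "'f \<Rightarrow> nat"
  rel_arity :: "'r \<Rightarrow> nat"

record ('a, 'f, 'r) fo_structure =
  univ :: "'a set"
  fun_int :: "'f \<Rightarrow> 'a list \<Rightarrow> 'a"
  rel_int :: "'r \<Rightarrow> 'a list set"

definition tuples :: "'a set \<Rightarrow> nat \<Rightarrow> 'a list set" where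
  "tuples A n = {xs. set xs \<subseteq> A \<and> length xs = n}"

text \<open>Interpretations are fixed outside their intended domain, so that equality of records is
  equality of structures.\<close>

definition is_structure :: "('f, 'r) vocabulary \<Rightarrow> ('a, 'f, 'r) fo_structure \<Rightarrow> bool" where
  "is_structure \<tau> M \<longleftrightarrow>
     univ M \<noteq> {} \<and>
     (\<forall>f\<in>Funs \<tau>. fun_int M f \<in> tuples (univ M) (fun_arity \<tau> f) \<rightarrow>\<^sub>E univ M) \<and>
     (\<forall>f. f \<notin> Funs \<tau> \<longrightarrow> fun_int M f = (\<lambda>_. undefined)) \<and>
     (\<forall>R\<in>Rels \<tau>. rel_int M R \<subseteq> tuples (univ M) (rel_arity \<tau> R)) \<and>
     (\<forall>R. R \<notin> Rels \<tau> \<longrightarrow> rel_int M R = {})"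

definition substructure ::
  "('f, 'r) vocabulary \<Rightarrow> ('a, 'f, 'r) fo_structure \<Rightarrow> ('a, 'f, 'r) fo_structure \<Rightarrow> bool" where
  "substructure \<tau> M N \<longleftrightarrow>
     is_structure \<tau> M \<and> is_structure \<tau> N \<and> univ M \<subseteq> univ N \<and>
     (\<forall>f\<in>Funs \<tau>. \<forall>xs\<in>tuples (univ M) (fun_arity \<tau> f). fun_int M f xs = fun_int N f xs) \<and>
     (\<forall>R\<in>Rels \<tau>. \<forall>xs\<in>tuples (univ M) (rel_arity \<tau> R). xs \<in> rel_int M R \<longleftrightarrow> xs \<in> rel_int N R)"

definition isomorphism ::
  "('f, 'r) vocabulary \<Rightarrow> ('a \<Rightarrow> 'a) \<Rightarrow> ('a, 'f, 'r) fo_structure \<Rightarrow> ('a, 'f, 'r) fo_structure \<Rightarrow> bool"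
  where
  "isomorphism \<tau> h M N \<longleftrightarrow>
     is_structure \<tau> M \<and> is_structure \<tau> N \<and> bij_betw h (univ M) (univ N) \<and>
     (\<forall>f\<in>Funs \<tau>. \<forall>xs\<in>tuples (univ M) (fun_arity \<tau> f).
        h (fun_int M f xs) = fun_int N f (map h xs)) \<and>
     (\<forall>R\<in>Rels \<tau>. \<forall>xs\<in>tuples (univ M) (rel_arity \<tau> R).
        xs \<in> rel_int M R \<longleftrightarrow> map h xs \<in> rel_int N R)"

text \<open>The union of a family \<open>C\<close> of structures; the definite description is meaningful when \<open>C\<close>
  is a chain under \<^const>\<open>substructure\<close>.\<close>

definition union_structure ::
  "('f, 'r) vocabulary \<Rightarrow> ('a, 'f, 'r) fo_structure set \<Rightarrow> ('a, 'f, 'r) fo_structure" where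
  "union_structure \<tau> C =
     \<lparr> univ = (\<Union>M\<in>C. univ M),
       fun_int = (\<lambda>f. if f \<in> Funs \<tau>
          then restrict
            (\<lambda>xs. THE y. \<exists>M\<in>C. xs \<in> tuples (univ M) (fun_arity \<tau> f) \<and> y = fun_int M f xs)
            (tuples (\<Union>M\<in>C. univ M) (fun_arity \<tau> f))
          else (\<lambda>_. undefined)),
       rel_int = (\<lambda>R. \<Union>M\<in>C. rel_int M R) \<rparr>"


section \<open>Abstract elementary classes\<close>

text \<open>The index set of a chain is the field of a well-order \<open>r\<close>, which plays the role of an
  ordinal.\<close>

definition limit_index :: "'i rel \<Rightarrow> 'i \<Rightarrow> bool" where
  "limit_index r i \<longleftrightarrow>
     i \<in> Field r \<and> underS r i \<noteq> {} \<and> (\<forall>j\<in>underS r i. \<exists>k\<in>underS r i. j \<in> underS r k)"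

definition continuous_chain ::
  "('f, 'r) vocabulary \<Rightarrow> (('a, 'f, 'r) fo_structure \<Rightarrow> ('a, 'f, 'r) fo_structure \<Rightarrow> bool) \<Rightarrow>
   'i rel \<Rightarrow> ('i \<Rightarrow> ('a, 'f, 'r) fo_structure) \<Rightarrow> bool" where
  "continuous_chain \<tau> sub r M \<longleftrightarrow>
     Well_order r \<and> Field r \<noteq> {} \<and>
     (\<forall>i j. (i, j) \<in> r \<longrightarrow> sub (M i) (M j)) \<and>
     (\<forall>i. limit_index r i \<longrightarrow> M i = union_structure \<tau> (M ` underS r i))"

definition LS_bound ::
  "('f, 'r) vocabulary \<Rightarrow> ('a, 'f, 'r) fo_structure set \<Rightarrow>
   (('a, 'f, 'r) fo_structure \<Rightarrow> ('a, 'f, 'r) fo_structure \<Rightarrow> bool) \<Rightarrow> 'l rel \<Rightarrow> bool" where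
  "LS_bound \<tau> K sub \<mu> \<longleftrightarrow>
     Card_order \<mu> \<and> natLeq \<le>o \<mu> \<and> |Funs \<tau>| \<le>o \<mu> \<and> |Rels \<tau>| \<le>o \<mu> \<and>
     (\<forall>M\<in>K. \<forall>A. A \<subseteq> univ M \<longrightarrow>
        (\<exists>M'\<in>K. A \<subseteq> univ M' \<and> sub M' M \<and> |univ M'| \<le>o |A| +c \<mu>))"

text \<open>
  \<open>LS\<close> is the Loewenheim--Skolem number: the least infinite cardinal that bounds the size of the
  vocabulary and satisfies the downward Loewenheim--Skolem property. Every cardinal below \<open>LS\<close> has
  a representative in the type of \<open>LS\<close>, so quantifying over that type suffices for minimality.

  All models have their universe inside the type \<open>'a\<close>, which is arbitrary. Chains are indexed by
  well-orders on subsets of \<open>'a\<close>. If \<open>'a\<close> is infinite, longer chains give nothing new: a strictly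
  increasing well-ordered chain of subsets of \<open>'a\<close> has at most \<open>|'a|\<close> members, and omitting
  repetitions changes neither continuity nor the union.
\<close>

locale abstract_elementary_class =
  fixes \<tau> :: "('f, 'r) vocabulary"
    and K :: "('a, 'f, 'r) fo_structure set"
    and sub :: "('a, 'f, 'r) fo_structure \<Rightarrow> ('a, 'f, 'r) fo_structure \<Rightarrow> bool"
    and LS :: "'l rel"
  assumes structures: "M \<in> K \<Longrightarrow> is_structure \<tau> M"
    and iso_closed: "M \<in> K \<Longrightarrow> isomorphism \<tau> h M N \<Longrightarrow> N \<in> K"
    and sub_iso_closed: "sub M N \<Longrightarrow> isomorphism \<tau> h N N' \<Longrightarrow> substructure \<tau> M' N' \<Longrightarrow>
          isomorphism \<tau> h M M' \<Longrightarrow> sub M' N'"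
    and sub_models: "sub M N \<Longrightarrow> M \<in> K \<and> N \<in> K"
    and sub_refl: "M \<in> K \<Longrightarrow> sub M M"
    and sub_trans: "sub M N \<Longrightarrow> sub N P \<Longrightarrow> sub M P"
    and sub_antisym: "sub M N \<Longrightarrow> sub N M \<Longrightarrow> M = N"
    and sub_substructure: "sub M N \<Longrightarrow> substructure \<tau> M N"
    and coherence: "sub M\<^sub>0 N \<Longrightarrow> sub M\<^sub>1 N \<Longrightarrow> substructure \<tau> M\<^sub>0 M\<^sub>1 \<Longrightarrow> sub M\<^sub>0 M\<^sub>1"
    and chain_union: "continuous_chain \<tau> sub (r :: 'a rel) C \<Longrightarrow>
          union_structure \<tau> (C ` Field r) \<in> K"
    and chain_upper: "continuous_chain \<tau> sub (r :: 'a rel) C \<Longrightarrow> i \<in> Field r \<Longrightarrow>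
          sub (C i) (union_structure \<tau> (C ` Field r))"
    and chain_smooth: "continuous_chain \<tau> sub (r :: 'a rel) C \<Longrightarrow>
          (\<And>i. i \<in> Field r \<Longrightarrow> sub (C i) N) \<Longrightarrow> sub (union_structure \<tau> (C ` Field r)) N"
    and LS_bound: "LS_bound \<tau> K sub LS"
    and LS_least: "LS_bound \<tau> K sub (\<mu> :: 'l rel) \<Longrightarrow> LS \<le>o \<mu>"

definition K_embedding ::
  "('f, 'r) vocabulary \<Rightarrow> (('a, 'f, 'r) fo_structure \<Rightarrow> ('a, 'f, 'r) fo_structure \<Rightarrow> bool) \<Rightarrow>
   ('a \<Rightarrow> 'a) \<Rightarrow> ('a, 'f, 'r) fo_structure \<Rightarrow> ('a, 'f, 'r) fo_structure \<Rightarrow> bool" where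
  "K_embedding \<tau> sub f M N \<longleftrightarrow> (\<exists>N'. sub N' N \<and> isomorphism \<tau> f M N')"

definition models_below ::
  "('a, 'f, 'r) fo_structure set \<Rightarrow> 'l rel \<Rightarrow> 'k rel \<Rightarrow> ('a, 'f, 'r) fo_structure set" where
  "models_below K LS \<kappa> = {M \<in> K. LS \<le>o |univ M| \<and> |univ M| <o \<kappa>}"

text \<open>In the following properties the given models range over \<open>D\<close>, which is either all of \<open>K\<close> or
  \<^term>\<open>models_below K LS \<kappa>\<close>; the model \<open>N\<close> found is only required to be in \<open>K\<close>.\<close>

definition amalgamation ::
  "('f, 'r) vocabulary \<Rightarrow> ('a, 'f, 'r) fo_structure set \<Rightarrow>
   (('a, 'f, 'r) fo_structure \<Rightarrow> ('a, 'f, 'r) fo_structure \<Rightarrow> bool) \<Rightarrow>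
   ('a, 'f, 'r) fo_structure set \<Rightarrow> bool" where
  "amalgamation \<tau> K sub D \<longleftrightarrow>
     (\<forall>M\<^sub>0\<in>D. \<forall>M\<^sub>1\<in>D. \<forall>M\<^sub>2\<in>D. sub M\<^sub>0 M\<^sub>1 \<and> sub M\<^sub>0 M\<^sub>2 \<longrightarrow>
        (\<exists>N\<in>K. \<exists>f\<^sub>1 f\<^sub>2. K_embedding \<tau> sub f\<^sub>1 M\<^sub>1 N \<and> K_embedding \<tau> sub f\<^sub>2 M\<^sub>2 N \<and>
           (\<forall>x\<in>univ M\<^sub>0. f\<^sub>1 x = f\<^sub>2 x)))"

definition disjoint_amalgamation ::
  "('f, 'r) vocabulary \<Rightarrow> ('a, 'f, 'r) fo_structure set \<Rightarrow>
   (('a, 'f, 'r) fo_structure \<Rightarrow> ('a, 'f, 'r) fo_structure \<Rightarrow> bool) \<Rightarrow>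
   ('a, 'f, 'r) fo_structure set \<Rightarrow> bool" where
  "disjoint_amalgamation \<tau> K sub D \<longleftrightarrow>
     (\<forall>M\<^sub>0\<in>D. \<forall>M\<^sub>1\<in>D. \<forall>M\<^sub>2\<in>D. sub M\<^sub>0 M\<^sub>1 \<and> sub M\<^sub>0 M\<^sub>2 \<longrightarrow>
        (\<exists>N\<in>K. \<exists>f\<^sub>1 f\<^sub>2. K_embedding \<tau> sub f\<^sub>1 M\<^sub>1 N \<and> K_embedding \<tau> sub f\<^sub>2 M\<^sub>2 N \<and>
           (\<forall>x\<in>univ M\<^sub>0. f\<^sub>1 x = f\<^sub>2 x) \<and>
           f\<^sub>1 ` univ M\<^sub>1 \<inter> f\<^sub>2 ` univ M\<^sub>2 = f\<^sub>1 ` univ M\<^sub>0))"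

definition joint_embedding ::
  "('f, 'r) vocabulary \<Rightarrow> ('a, 'f, 'r) fo_structure set \<Rightarrow>
   (('a, 'f, 'r) fo_structure \<Rightarrow> ('a, 'f, 'r) fo_structure \<Rightarrow> bool) \<Rightarrow>
   ('a, 'f, 'r) fo_structure set \<Rightarrow> bool" where
  "joint_embedding \<tau> K sub D \<longleftrightarrow>
     (\<forall>M\<^sub>1\<in>D. \<forall>M\<^sub>2\<in>D.
        \<exists>N\<in>K. \<exists>f\<^sub>1 f\<^sub>2. K_embedding \<tau> sub f\<^sub>1 M\<^sub>1 N \<and> K_embedding \<tau> sub f\<^sub>2 M\<^sub>2 N)"


section \<open>Strongly compact cardinals\<close>

definition complete_filter :: "'k rel \<Rightarrow> 'i filter \<Rightarrow> bool" where
  "complete_filter \<kappa> F \<longleftrightarrow>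
     (\<forall>\<S>. |\<S>| <o \<kappa> \<longrightarrow> (\<forall>S\<in>\<S>. \<forall>\<^sub>F x in F. x \<in> S) \<longrightarrow> (\<forall>\<^sub>F x in F. x \<in> \<Inter>\<S>))"

definition ultrafilter :: "'i filter \<Rightarrow> bool" where
  "ultrafilter U \<longleftrightarrow> U \<noteq> bot \<and> (\<forall>P. (\<forall>\<^sub>F x in U. P x) \<or> (\<forall>\<^sub>F x in U. \<not> P x))"

text \<open>
  A filter on a set \<open>X\<close> is a filter \<open>F\<close> on the ambient type with \<^prop>\<open>F \<le> principal X\<close>, and
  \<^prop>\<open>U \<le> F\<close> says that \<open>U\<close> extends \<open>F\<close>. A formula cannot quantify over types, so the type \<open>'i\<close>
  from which the sets \<open>X\<close> are taken is a parameter; full strong compactness is the conjunction of all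
  instances.
\<close>

definition strongly_compact :: "'i itself \<Rightarrow> 'k rel \<Rightarrow> bool" where
  "strongly_compact _ \<kappa> \<longleftrightarrow>
     Card_order \<kappa> \<and>
     (\<forall>(X :: 'i set) F. F \<noteq> bot \<and> F \<le> principal X \<and> complete_filter \<kappa> F \<longrightarrow>
        (\<exists>U. U \<le> F \<and> ultrafilter U \<and> complete_filter \<kappa> U))"

end

theory Submission
  imports Defs
begin

text \<open>
  Fix models to be amalgamated and a fine \<open>\<kappa>\<close>-complete ultrafilter \<open>U\<close> on the sets \<open>s\<close> of
  size below \<open>\<kappa>\<close>. For each \<open>s\<close> choose strong submodels of size below \<open>\<kappa>\<close> containing the part of
  \<open>s\<close> in the given models, and amalgamate them in some \<open>N s\<close>. In the ultraproduct of the
  \<open>N s\<close> take a Skolem hull \<open>H\<close> of the images of the given models: it is a directed union of pieces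
  of size \<open>LS\<close>, and by \<open>\<kappa>\<close>-completeness each piece is isomorphic to a strong submodel
  of almost all \<open>N s\<close>, compatibly with strong inclusion. As abstract elementary classes are
  closed under directed unions, \<open>H\<close> is a model, and the same argument shows that the given
  models embed strongly. Equality in \<open>H\<close> is equality almost everywhere, which transfers
  agreement on the base and disjointness.
\<close>

section \<open>Induced structures and directed unions\<close>

text \<open>Strong inclusion is given by axioms only, so the analogue of Los's theorem is confined
  to atomic formulas, and strong inclusion has to be carried from \<open>N s\<close> to the hull
  along isomorphisms. A single \<open>s\<close> yields such an isomorphism only if fewer than
  \<kappa> atomic statements are involved, hence pieces of size \<open>LS\<close>. Skolem functions
  are replaced by a monotone assignment of small strong sets to finite sets of generators;
  monotonicity makes the pieces directed. The chain axioms see only well-orders on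
  \<open>'a\<close>, so the hull must be generated by no more functions than \<open>'a\<close> has
  elements. That every model has at least \<open>LS\<close> elements serves twice: it puts the small
  submodels into \<open>models_below\<close>, and it makes \<open>'a\<close> large enough to hold
  the hull. Strong submodels are written \<open>induced \<tau> N X\<close>, so that directed systems
  of structures become directed systems of sets.\<close>

definition induced :: "('f, 'r) vocabulary \<Rightarrow> ('a, 'f, 'r) fo_structure \<Rightarrow> 'a set \<Rightarrow> ('a, 'f, 'r) fo_structure"
  where
  "induced \<tau> N X =
     \<lparr> univ = X,
       fun_int = (\<lambda>f. if f \<in> Funs \<tau> then restrict (fun_int N f) (tuples X (fun_arity \<tau> f))
          else (\<lambda>_. undefined)),
       rel_int = (\<lambda>R. if R \<in> Rels \<tau> then rel_int N R \<inter> tuples X (rel_arity \<tau> R) else {}) \<rparr>"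

definition closed_in :: "('f, 'r) vocabulary \<Rightarrow> ('a, 'f, 'r) fo_structure \<Rightarrow> 'a set \<Rightarrow> bool" where
  "closed_in \<tau> N X \<longleftrightarrow> X \<noteq> {} \<and> X \<subseteq> univ N \<and>
     (\<forall>f\<in>Funs \<tau>. \<forall>xs\<in>tuples X (fun_arity \<tau> f). fun_int N f xs \<in> X)"

lemma univ_induced [simp]: "univ (induced \<tau> N X) = X"
  by (simp add: induced_def)

lemma tuples_mono: "X \<subseteq> Y \<Longrightarrow> tuples X n \<subseteq> tuples Y n"
  by (auto simp: tuples_def)

lemma map_in_tuples: "xs \<in> tuples A n \<Longrightarrow> h ` A \<subseteq> B \<Longrightarrow> map h xs \<in> tuples B n"
  by (auto simp: tuples_def)

lemma in_tuples_imageE: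
  assumes "ys \<in> tuples (h ` A) n"
  obtains xs where "xs \<in> tuples A n" "ys = map h xs"
proof -
  have "ys \<in> map h ` lists A" using assms by (auto simp: tuples_def simp flip: lists_image)
  then obtain xs where "ys = map h xs" "set xs \<subseteq> A" by auto
  with assms that show thesis by (auto simp: tuples_def)
qed

lemma induced_induced: "X \<subseteq> Y \<Longrightarrow> induced \<tau> (induced \<tau> N Y) X = induced \<tau> N X"
  using tuples_mono[of X Y]
  by (auto simp: induced_def fun_eq_iff restrict_def intro!: fo_structure.equality)

lemma is_structure_induced:
  assumes "is_structure \<tau> N" "closed_in \<tau> N X"
  shows "is_structure \<tau> (induced \<tau> N X)"
  using assms by (auto simp: is_structure_def closed_in_def induced_def)

lemma closed_inI_induced:
  assumes "is_structure \<tau> (induced \<tau> N X)" "X \<subseteq> univ N"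
  shows "closed_in \<tau> N X"
  using assms by (fastforce simp: is_structure_def closed_in_def induced_def PiE_def Pi_def)

lemma substructure_induced:
  assumes "is_structure \<tau> N" "closed_in \<tau> N X"
  shows "substructure \<tau> (induced \<tau> N X) N"
  using assms is_structure_induced[OF assms]
  by (auto simp: substructure_def closed_in_def) (auto simp: induced_def)

lemma substructure_inducedI:
  assumes "is_structure \<tau> N" "closed_in \<tau> N X" "closed_in \<tau> N Y" "X \<subseteq> Y"
  shows "substructure \<tau> (induced \<tau> N X) (induced \<tau> N Y)"
  using assms is_structure_induced[OF assms(1)] tuples_mono[OF assms(4)]
  by (auto simp: substructure_def) (auto simp: induced_def)

lemma induced_univ:
  assumes "is_structure \<tau> N"
  shows "induced \<tau> N (univ N) = N"
proof (rule fo_structure.equality)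
  show "fun_int (induced \<tau> N (univ N)) = fun_int N"
  proof
    fix f show "fun_int (induced \<tau> N (univ N)) f = fun_int N f"
      using assms by (cases "f \<in> Funs \<tau>") (auto simp: induced_def is_structure_def PiE_restrict)
  qed
  show "rel_int (induced \<tau> N (univ N)) = rel_int N"
    using assms by (fastforce simp: induced_def is_structure_def fun_eq_iff)
qed simp_all

lemma substructure_eq_induced:
  assumes "substructure \<tau> M N"
  shows "M = induced \<tau> N (univ M)"
proof -
  have M: "is_structure \<tau> M" using assms by (simp add: substructure_def)
  have "induced \<tau> N (univ M) = induced \<tau> M (univ M)"
    using assms M by (auto simp: induced_def substructure_def is_structure_def fun_eq_iff restrict_def)
  then show ?thesis by (simp add: induced_univ[OF M])
qed

lemma substructure_closed_in:
  assumes "substructure \<tau> M N"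
  shows "closed_in \<tau> N (univ M)"
  using assms substructure_eq_induced[OF assms]
  by (metis closed_inI_induced substructure_def)

text \<open>A tuple has finitely many entries and so lies in one member of the family, where the
  operations are those of \<open>N\<close>. The instance \<open>A = {}\<close> of \<open>fin\<close>
  provides such a member for constants too.\<close>

lemma union_structure_induced:
  assumes fin: "\<And>A. finite A \<Longrightarrow> A \<subseteq> \<Union>\<X> \<Longrightarrow> \<exists>X\<in>\<X>. A \<subseteq> X"
  shows "union_structure \<tau> (induced \<tau> N ` \<X>) = induced \<tau> N (\<Union>\<X>)"
proof (rule fo_structure.equality)
  have *: "\<exists>X\<in>\<X>. xs \<in> tuples X n" if "xs \<in> tuples (\<Union>\<X>) n" for xs n
    using fin[of "set xs"] that by (auto simp: tuples_def)
  show "univ (union_structure \<tau> (induced \<tau> N ` \<X>)) = univ (induced \<tau> N (\<Union>\<X>))"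
    by (simp add: union_structure_def)
  show "fun_int (union_structure \<tau> (induced \<tau> N ` \<X>)) = fun_int (induced \<tau> N (\<Union>\<X>))"
  proof
    fix f
    have "(THE y. \<exists>M\<in>induced \<tau> N ` \<X>. xs \<in> tuples (univ M) (fun_arity \<tau> f) \<and> y = fun_int M f xs)
        = fun_int N f xs"
      if "xs \<in> tuples (\<Union>\<X>) (fun_arity \<tau> f)" "f \<in> Funs \<tau>" for xs
      using *[OF that(1)] that(2) by (intro the_equality) (auto simp: induced_def)
    then show "fun_int (union_structure \<tau> (induced \<tau> N ` \<X>)) f = fun_int (induced \<tau> N (\<Union>\<X>)) f"
      by (auto simp: union_structure_def induced_def fun_eq_iff restrict_def)
  qed
  show "rel_int (union_structure \<tau> (induced \<tau> N ` \<X>)) = rel_int (induced \<tau> N (\<Union>\<X>))"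
  proof
    fix R
    show "rel_int (union_structure \<tau> (induced \<tau> N ` \<X>)) R = rel_int (induced \<tau> N (\<Union>\<X>)) R"
      using *[of _ "rel_arity \<tau> R"] tuples_mono[of _ "\<Union>\<X>" "rel_arity \<tau> R"]
      by (auto simp: union_structure_def induced_def)
  qed
qed simp

lemma isomorphism_induced_subset:
  assumes iso: "isomorphism \<tau> h M N" and X: "closed_in \<tau> M X"
  shows "closed_in \<tau> N (h ` X)" "isomorphism \<tau> h (induced \<tau> M X) (induced \<tau> N (h ` X))"
proof -
  have M: "is_structure \<tau> M" and N: "is_structure \<tau> N" and b: "bij_betw h (univ M) (univ N)"
    and F: "\<And>f xs. f \<in> Funs \<tau> \<Longrightarrow> xs \<in> tuples (univ M) (fun_arity \<tau> f) \<Longrightarrow>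
        h (fun_int M f xs) = fun_int N f (map h xs)"
    and R: "\<And>R xs. R \<in> Rels \<tau> \<Longrightarrow> xs \<in> tuples (univ M) (rel_arity \<tau> R) \<Longrightarrow>
        xs \<in> rel_int M R \<longleftrightarrow> map h xs \<in> rel_int N R"
    using iso by (auto simp: isomorphism_def)
  have XM: "X \<subseteq> univ M" using X by (simp add: closed_in_def)
  note tup = subsetD[OF tuples_mono[OF XM]]
  show cl: "closed_in \<tau> N (h ` X)"
    unfolding closed_in_def
  proof (intro conjI ballI)
    show "h ` X \<noteq> {}" "h ` X \<subseteq> univ N" using X b by (auto simp: closed_in_def bij_betw_def)
    fix f ys assume f: "f \<in> Funs \<tau>" and "ys \<in> tuples (h ` X) (fun_arity \<tau> f)"
    then obtain xs where xs: "xs \<in> tuples X (fun_arity \<tau> f)" "ys = map h xs"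
      by (elim in_tuples_imageE)
    have "fun_int M f xs \<in> X" using X f xs by (auto simp: closed_in_def)
    then show "fun_int N f ys \<in> h ` X" using F[OF f tup[OF xs(1)]] xs by (metis imageI)
  qed
  have m: "map h xs \<in> tuples (h ` X) n" if "xs \<in> tuples X n" for xs n
    using that by (rule map_in_tuples) simp
  show "isomorphism \<tau> h (induced \<tau> M X) (induced \<tau> N (h ` X))"
    unfolding isomorphism_def
  proof (intro conjI ballI)
    show "is_structure \<tau> (induced \<tau> M X)" "is_structure \<tau> (induced \<tau> N (h ` X))"
      using M N X cl by (auto intro: is_structure_induced)
    show "bij_betw h (univ (induced \<tau> M X)) (univ (induced \<tau> N (h ` X)))"
      using b XM by (auto simp: bij_betw_def inj_on_subset)
  qed (use F R tup m in \<open>auto simp: induced_def\<close>)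
qed

lemma finite_subset_directed_union:
  assumes "finite B" "B \<subseteq> (\<Union>A\<in>Fpow Y. c A)"
    and mono: "\<And>A B. B \<in> Fpow Y \<Longrightarrow> A \<subseteq> B \<Longrightarrow> c A \<subseteq> c B"
  shows "\<exists>A\<in>Fpow Y. B \<subseteq> c A"
  using assms(1,2)
proof (induction B rule: finite_induct)
  case empty
  then show ?case using empty_in_Fpow by auto
next
  case (insert x B)
  then obtain A A' where A: "A \<in> Fpow Y" "B \<subseteq> c A" "A' \<in> Fpow Y" "x \<in> c A'" by auto
  then have "A \<union> A' \<in> Fpow Y" by (auto simp: Fpow_def)
  then show ?case using A mono[of "A \<union> A'" A] mono[of "A \<union> A'" A'] by blast
qed

text \<open>Linearity gives a maximum of two bounds. It is only a weak bound for the new element;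
  since \<open>S\<close> has no last element, one more step inside \<open>S\<close> makes it
  strict.\<close>

lemma finite_subset_underS:
  assumes r: "Well_order r" and S: "S \<subseteq> Field r" "S \<noteq> {}" "\<forall>j\<in>S. \<exists>k\<in>S. j \<in> underS r k"
    and "finite A" "A \<subseteq> S"
  shows "\<exists>k\<in>S. A \<subseteq> underS r k"
  using assms(5,6)
proof (induction A rule: finite_induct)
  case empty
  then show ?case using S by auto
next
  case (insert a A)
  then obtain k where k: "k \<in> S" "A \<subseteq> underS r k" by auto
  obtain m where m: "m \<in> S" "(k, m) \<in> r" "(a, m) \<in> r"
    using k insert.prems S wo_rel.TOTALS[of r] r unfolding wo_rel_def by blast
  obtain n where n: "n \<in> S" "m \<in> underS r n" using S m by auto
  have tr: "trans r" "antisym r"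
    using r by (auto simp: well_order_on_def linear_order_on_def partial_order_on_def preorder_on_def)
  have "x \<in> underS r n" if "(x, m) \<in> r" for x
    using n that tr unfolding underS_def by (auto dest: transD antisymD)
  moreover have "(x, m) \<in> r" if "x \<in> A" for x
    using that k m tr unfolding underS_def by (blast dest: transD)
  ultimately show ?case using n m by blast
qed

section \<open>Directed unions in an abstract elementary class\<close>

context abstract_elementary_class
begin

lemma sub_univ: "sub M N \<Longrightarrow> univ M \<subseteq> univ N"
  using sub_substructure by (auto simp: substructure_def)

lemma sub_induced: "sub M N \<Longrightarrow> M = induced \<tau> N (univ M)"
  using sub_substructure substructure_eq_induced by blast

lemma sub_closed_in: "sub M N \<Longrightarrow> closed_in \<tau> N (univ M)"
  using sub_substructure substructure_closed_in by blast

text \<open>A directed system indexed by the finite subsets of a set \<open>Y\<close> is the union of a continuous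
  chain: enumerate \<open>Y\<close> in order type \<open>|Y|\<close> and apply induction on cardinality to the initial
  segments. The structures are all induced by one ambient \<open>N\<close>, which need not be a model.\<close>

lemma directed_union_same_type:
  fixes Y :: "'a set"
  assumes "\<And>A B. B \<in> Fpow Y \<Longrightarrow> A \<subseteq> B \<Longrightarrow> sub (induced \<tau> N (c A)) (induced \<tau> N (c B))"
  shows "induced \<tau> N (\<Union>A\<in>Fpow Y. c A) \<in> K \<and>
    (\<forall>A\<in>Fpow Y. sub (induced \<tau> N (c A)) (induced \<tau> N (\<Union>A\<in>Fpow Y. c A))) \<and>
    (\<forall>P. (\<forall>A\<in>Fpow Y. sub (induced \<tau> N (c A)) P) \<longrightarrow> sub (induced \<tau> N (\<Union>A\<in>Fpow Y. c A)) P)"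
  using assms
proof (induction Y rule: wf_induct[OF wf_inv_image[OF wf_ordLess, of card_of]])
  case (1 Y)
  note csub = 1(2)
  define D where "D Z = (\<Union>A\<in>Fpow Z. c A)" for Z
  have mono: "c A \<subseteq> c B" if "B \<in> Fpow Y" "A \<subseteq> B" for A B
    using sub_univ[OF csub[OF that]] by simp
  have cK: "induced \<tau> N (c A) \<in> K" if "A \<in> Fpow Y" for A
    using csub[OF that subset_refl] sub_models by blast
  show ?case
  proof (cases "finite Y")
    case True
    \<comment> \<open>A finite \<open>Y\<close> is itself an index, and the largest one, so the
      union is \<open>c Y\<close>.\<close>
    then have Y: "Y \<in> Fpow Y" by (auto simp: Fpow_def)
    have "(\<Union>A\<in>Fpow Y. c A) = c Y" using Y mono[OF Y] by (auto simp: Fpow_def)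
    then show ?thesis using Y cK csub[OF Y] by (auto simp: Fpow_def)
  next
    case False
    define r where "r = |Y|"
    have Card: "Card_order r" and F: "Field r = Y" and W: "Well_order r"
      by (auto simp: r_def Field_card_of card_of_card_order_on card_of_well_order_on)
    have tr: "trans r" "antisym r"
      using W by (auto simp: well_order_on_def linear_order_on_def partial_order_on_def preorder_on_def)
    define C where "C i = induced \<tau> N (D (underS r i))" for i
    have uY: "underS r i \<subseteq> Y" for i using F by (auto simp: underS_def Field_def)
    have IH: "induced \<tau> N (D (underS r i)) \<in> K \<and>
       (\<forall>A\<in>Fpow (underS r i). sub (induced \<tau> N (c A)) (induced \<tau> N (D (underS r i)))) \<and>
       (\<forall>P. (\<forall>A\<in>Fpow (underS r i). sub (induced \<tau> N (c A)) P) \<longrightarrow> sub (induced \<tau> N (D (underS r i))) P)"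
      if "i \<in> Y" for i
      unfolding D_def
    proof (rule 1(1)[rule_format])
      \<comment> \<open>\<open>r\<close> is a cardinal order, so its proper initial segments are
        strictly smaller than \<open>Y\<close>.\<close>
      show "(underS r i, Y) \<in> inv_image ordLess card_of"
        using card_of_underS[OF Card] that F by (auto simp: r_def)
    qed (use csub Fpow_mono[OF uY[of i]] in auto)
    have Csub: "sub (C i) (C j)" if "(i, j) \<in> r" for i j
    proof -
      have ij: "i \<in> Y" "j \<in> Y" using that F by (auto simp: Field_def)
      have "underS r i \<subseteq> underS r j"
        using that tr by (auto simp: underS_def dest: transD antisymD)
      then show ?thesis
        using IH[OF ij(1)] IH[OF ij(2)] Fpow_mono unfolding C_def by blast
    qed
    \<comment> \<open>This covers all non-empty initial segments without last element:
      \<open>underS r i\<close> at a limit \<open>i\<close> gives continuity, and \<open>Y\<close>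
      itself, whose infinite cardinal order has no last element, gives the union of the whole
      chain.\<close>
    have union: "union_structure \<tau> (C ` S) = induced \<tau> N (D S)"
      if S: "S \<subseteq> Y" "S \<noteq> {}" "\<forall>j\<in>S. underS r j \<subseteq> S \<and> (\<exists>k\<in>S. j \<in> underS r k)" for S
    proof -
      have ub: "\<exists>k\<in>S. A \<subseteq> underS r k" if "A \<in> Fpow S" for A
        using finite_subset_underS[OF W, of S A] S F that by (auto simp: Fpow_def)
      have DS: "\<Union> ((\<lambda>j. D (underS r j)) ` S) = D S"
      proof
        have "D (underS r j) \<subseteq> D S" if "j \<in> S" for j
          using Fpow_mono[of "underS r j" S] S(3) that by (fastforce simp: D_def)
        then show "\<Union> ((\<lambda>j. D (underS r j)) ` S) \<subseteq> D S" by blast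
        show "D S \<subseteq> \<Union> ((\<lambda>j. D (underS r j)) ` S)"
        proof
          fix x assume "x \<in> D S"
          then obtain A where A: "A \<in> Fpow S" "x \<in> c A" by (auto simp: D_def)
          then obtain k where "k \<in> S" "A \<subseteq> underS r k" using ub by blast
          then show "x \<in> \<Union> ((\<lambda>j. D (underS r j)) ` S)" using A by (auto simp: D_def Fpow_def)
        qed
      qed
      have "\<exists>X\<in>(\<lambda>j. D (underS r j)) ` S. B \<subseteq> X"
        if finB: "finite B" and B: "B \<subseteq> \<Union> ((\<lambda>j. D (underS r j)) ` S)" for B
      proof -
        have "B \<subseteq> (\<Union>A\<in>Fpow S. c A)" using B DS by (simp add: D_def)
        then obtain A where A: "A \<in> Fpow S" "B \<subseteq> c A"
          using finite_subset_directed_union[OF finB, of c S] mono Fpow_mono[OF S(1)] by blast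
        then obtain k where "k \<in> S" "A \<subseteq> underS r k" using ub by blast
        then show ?thesis using A by (auto simp: D_def Fpow_def)
      qed
      from union_structure_induced[OF this, of \<tau> N] show ?thesis
        by (simp add: DS image_image C_def)
    qed
    have down: "underS r k \<subseteq> underS r j" if "k \<in> underS r j" for j k
      using that tr by (auto simp: underS_def dest: transD antisymD)
    have chain: "continuous_chain \<tau> sub r C"
      unfolding continuous_chain_def
    proof (intro conjI allI impI)
      fix i assume i: "limit_index r i"
      have "union_structure \<tau> (C ` underS r i) = C i"
        unfolding C_def[of i]
        by (rule union) (use i uY down in \<open>auto simp: limit_index_def\<close>)
      then show "C i = union_structure \<tau> (C ` underS r i)" ..
    qed (use W F False Csub in auto)
    have total: "union_structure \<tau> (C ` Field r) = induced \<tau> N (D Y)"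
      unfolding F
    proof (rule union)
      show "\<forall>j\<in>Y. underS r j \<subseteq> Y \<and> (\<exists>k\<in>Y. j \<in> underS r k)"
        using infinite_Card_order_limit[OF Card] F False uY by (fastforce simp: underS_def)
    qed (use False in auto)
    have "sub (induced \<tau> N (c A)) (induced \<tau> N (D Y))" if A: "A \<in> Fpow Y" for A
    proof -
      obtain k where k: "k \<in> Y" "A \<subseteq> underS r k"
        using finite_subset_underS[OF W, of Y A] A F False infinite_Card_order_limit[OF Card]
        by (fastforce simp: Fpow_def underS_def)
      have "sub (induced \<tau> N (c A)) (C k)"
        using IH[OF k(1)] k(2) A by (auto simp: C_def Fpow_def)
      moreover have "sub (C k) (induced \<tau> N (D Y))"
        using chain_upper[OF chain] k F total by metis
      ultimately show ?thesis by (rule sub_trans)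
    qed
    moreover have "sub (induced \<tau> N (D Y)) P" if P: "\<forall>A\<in>Fpow Y. sub (induced \<tau> N (c A)) P" for P
    proof -
      have "sub (C i) P" if "i \<in> Y" for i
        using IH[OF that] P Fpow_mono[OF uY[of i]] unfolding C_def by blast
      then show ?thesis using chain_smooth[OF chain] F total by metis
    qed
    moreover have "induced \<tau> N (D Y) \<in> K" using chain_union[OF chain] total by metis
    ultimately show ?thesis unfolding D_def by blast
  qed
qed

text \<open>The hull will be indexed by finite sets of functions, while the chain axioms are
  restricted to well-orders on \<open>'a\<close>; an injection of \<open>Y\<close> into
  \<open>'a\<close> moves the index set there.\<close>

lemma directed_union:
  fixes Y :: "'y set"
  assumes Y: "|Y| \<le>o |UNIV :: 'a set|"
    and csub: "\<And>A B. B \<in> Fpow Y \<Longrightarrow> A \<subseteq> B \<Longrightarrow> sub (induced \<tau> N (c A)) (induced \<tau> N (c B))"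
  shows "induced \<tau> N (\<Union>A\<in>Fpow Y. c A) \<in> K"
    and "A \<in> Fpow Y \<Longrightarrow> sub (induced \<tau> N (c A)) (induced \<tau> N (\<Union>A\<in>Fpow Y. c A))"
    and "(\<And>A. A \<in> Fpow Y \<Longrightarrow> sub (induced \<tau> N (c A)) P) \<Longrightarrow>
           sub (induced \<tau> N (\<Union>A\<in>Fpow Y. c A)) P"
proof -
  obtain g :: "'y \<Rightarrow> 'a" where g: "inj_on g Y" using Y by (metis card_of_ordLeq)
  define h where "h = inv_into Y g"
  have F: "image h ` Fpow (g ` Y) = Fpow Y"
  proof -
    have "h ` A \<in> Fpow Y" if "A \<in> Fpow (g ` Y)" for A
      using that g by (auto simp: Fpow_def h_def inv_into_into)
    moreover have "A \<in> image h ` Fpow (g ` Y)" if "A \<in> Fpow Y" for A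
    proof
      show "A = h ` g ` A" using that g by (auto simp: Fpow_def h_def image_inv_into_cancel)
      show "g ` A \<in> Fpow (g ` Y)" using that by (auto simp: Fpow_def)
    qed
    ultimately show ?thesis by blast
  qed
  have U: "(\<Union>A\<in>Fpow (g ` Y). c (h ` A)) = (\<Union>A\<in>Fpow Y. c A)" by (simp flip: F)
  have "induced \<tau> N (\<Union>A\<in>Fpow (g ` Y). c (h ` A)) \<in> K \<and>
    (\<forall>A\<in>Fpow (g ` Y). sub (induced \<tau> N (c (h ` A))) (induced \<tau> N (\<Union>A\<in>Fpow (g ` Y). c (h ` A)))) \<and>
    (\<forall>P. (\<forall>A\<in>Fpow (g ` Y). sub (induced \<tau> N (c (h ` A))) P) \<longrightarrow>
       sub (induced \<tau> N (\<Union>A\<in>Fpow (g ` Y). c (h ` A))) P)"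
  proof (rule directed_union_same_type)
    fix A B assume B: "B \<in> Fpow (g ` Y)"
    then have hB: "h ` B \<in> Fpow Y" using F by blast
    show "sub (induced \<tau> N (c (h ` A))) (induced \<tau> N (c (h ` B)))" if "A \<subseteq> B"
      by (rule csub[OF hB image_mono[OF that]])
  qed
  then have *: "induced \<tau> N (\<Union>A\<in>Fpow Y. c A) \<in> K \<and>
    (\<forall>A\<in>image h ` Fpow (g ` Y). sub (induced \<tau> N (c A)) (induced \<tau> N (\<Union>A\<in>Fpow Y. c A))) \<and>
    (\<forall>P. (\<forall>A\<in>image h ` Fpow (g ` Y). sub (induced \<tau> N (c A)) P) \<longrightarrow>
       sub (induced \<tau> N (\<Union>A\<in>Fpow Y. c A)) P)"
    unfolding U by auto
  show "induced \<tau> N (\<Union>A\<in>Fpow Y. c A) \<in> K"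
    and "A \<in> Fpow Y \<Longrightarrow> sub (induced \<tau> N (c A)) (induced \<tau> N (\<Union>A\<in>Fpow Y. c A))"
    and "(\<And>A. A \<in> Fpow Y \<Longrightarrow> sub (induced \<tau> N (c A)) P) \<Longrightarrow>
           sub (induced \<tau> N (\<Union>A\<in>Fpow Y. c A)) P"
    using * unfolding F by blast+
qed

end

section \<open>Small sets and complete ultrafilters\<close>

lemma finite_ordLess_Cinfinite:
  assumes "finite X" "Cinfinite r"
  shows "|X| <o r"
  using assms(1) by (intro Cfinite_ordLess_Cinfinite[OF _ assms(2)])
    (auto simp: cfinite_def Field_card_of card_of_card_order_on)

lemma card_of_tuples:
  assumes "|A| \<le>o r" "Cinfinite r"
  shows "|tuples A n| \<le>o r"
proof (induction n)
  case 0
  have "tuples A 0 = {[]}" by (auto simp: tuples_def)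
  then show ?case by (simp add: ordLess_imp_ordLeq[OF finite_ordLess_Cinfinite[OF _ assms(2)]])
next
  case (Suc n)
  have "tuples A (Suc n) \<subseteq> (\<lambda>(x, xs). x # xs) ` (A \<times> tuples A n)"
  proof
    fix xs assume "xs \<in> tuples A (Suc n)"
    then show "xs \<in> (\<lambda>(x, xs). x # xs) ` (A \<times> tuples A n)"
      by (cases xs) (auto simp: tuples_def)
  qed
  then have "|tuples A (Suc n)| \<le>o |A \<times> tuples A n|" by (metis surj_imp_ordLeq)
  also have "|A \<times> tuples A n| \<le>o r"
    using card_of_Times_ordLeq_infinite_Field[of r A "tuples A n"] assms Suc
    by (auto simp: cinfinite_def)
  finally show ?case .
qed

lemma card_of_lists:
  assumes "|A| \<le>o r" "Cinfinite r"
  shows "|lists A| \<le>o r"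
proof -
  have "lists A = (\<Union>n. tuples A n)" by (auto simp: tuples_def)
  moreover have "|\<Union>n. tuples A n| \<le>o r"
  proof (rule UNION_Cinfinite_bound[OF _ _ assms(2)])
    show "|UNIV :: nat set| \<le>o r"
      using assms(2) natLeq_ordLeq_cinfinite[of r] card_of_nat ordIso_ordLeq_trans by blast
  qed (use card_of_tuples assms in blast)
  ultimately show ?thesis by simp
qed

lemma card_of_Fpow:
  assumes "|A| \<le>o r" "Cinfinite r"
  shows "|Fpow A| \<le>o r"
proof -
  have "Fpow A \<subseteq> set ` lists A"
  proof
    fix B assume "B \<in> Fpow A"
    then obtain xs where "set xs = B" "B \<subseteq> A" by (auto simp: Fpow_def dest: finite_list)
    then show "B \<in> set ` lists A" by auto
  qed
  then have "|Fpow A| \<le>o |lists A|" by (rule surj_imp_ordLeq)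
  then show ?thesis using card_of_lists[OF assms] ordLeq_transitive by blast
qed

text \<open>The substitute for Skolem functions. By recursion on proper inclusion,
  \<open>c A\<close> is a good set around \<open>A\<close> and all \<open>c A'\<close> with
  \<open>A'\<close> a proper subset of \<open>A\<close>; a finite set has finitely many of these, so
  the set to be extended keeps size at most \<open>r\<close>.\<close>

lemma monotone_finite_choice:
  fixes r :: "'l rel" and Z :: "'x set"
  assumes r: "Cinfinite r"
    and ext: "\<And>B. B \<subseteq> Z \<Longrightarrow> |B| \<le>o r \<Longrightarrow> \<exists>C. B \<subseteq> C \<and> C \<subseteq> Z \<and> |C| \<le>o r \<and> good C"
  obtains c where "\<And>A. A \<in> Fpow Z \<Longrightarrow> A \<subseteq> c A \<and> c A \<subseteq> Z \<and> |c A| \<le>o r \<and> good (c A)"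
    and "\<And>A B. B \<in> Fpow Z \<Longrightarrow> A \<subseteq> B \<Longrightarrow> c A \<subseteq> c B"
proof -
  obtain G where G: "\<And>B. B \<subseteq> Z \<Longrightarrow> |B| \<le>o r \<Longrightarrow> B \<subseteq> G B \<and> G B \<subseteq> Z \<and> |G B| \<le>o r \<and> good (G B)"
    using ext by metis
  define c where "c = wfrec finite_psubset (\<lambda>c A. G (A \<union> \<Union> (c ` {A'. A' \<subset> A})))"
  have c: "c A = G (A \<union> \<Union> (c ` {A'. A' \<subset> A}))" if "finite A" for A
  proof -
    have "cut c finite_psubset A ` {A'. A' \<subset> A} = c ` {A'. A' \<subset> A}"
      using that by (intro image_cong) (auto simp: cut_def)
    then show ?thesis
      using wfrec[OF wf_finite_psubset, of "\<lambda>c A. G (A \<union> \<Union> (c ` {A'. A' \<subset> A}))" A]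
      unfolding c_def[symmetric] by simp
  qed
  have *: "A \<subseteq> c A \<and> c A \<subseteq> Z \<and> |c A| \<le>o r \<and> good (c A) \<and> (\<forall>A'. A' \<subset> A \<longrightarrow> c A' \<subseteq> c A)"
    if "finite A" "A \<subseteq> Z" for A
    using that
  proof (induction A rule: finite_psubset_induct)
    case (psubset A)
    let ?B = "A \<union> \<Union> (c ` {A'. A' \<subset> A})"
    have IH: "c A' \<subseteq> Z" "|c A'| \<le>o r" if "A' \<subset> A" for A'
      using psubset that by blast+
    have fin: "finite {A'. A' \<subset> A}"
      by (rule finite_subset[of _ "Pow A"]) (use psubset.hyps in auto)
    have finr: "|X| \<le>o r" if "finite X" for X
      using finite_ordLess_Cinfinite[OF that r] by (rule ordLess_imp_ordLeq)
    have "|\<Union> (c ` {A'. A' \<subset> A})| \<le>o r"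
      by (rule UNION_Cinfinite_bound[OF finr[OF fin] _ r]) (use IH in auto)
    then have "|?B| \<le>o r" using finr psubset.hyps r by (intro Un_Cinfinite_bound) auto
    moreover have "?B \<subseteq> Z" using IH psubset.prems by blast
    ultimately have "?B \<subseteq> c A \<and> c A \<subseteq> Z \<and> |c A| \<le>o r \<and> good (c A)"
      using G c[OF psubset.hyps] by metis
    then show ?case by blast
  qed
  show thesis
  proof (rule that)
    fix A assume "A \<in> Fpow Z"
    then show "A \<subseteq> c A \<and> c A \<subseteq> Z \<and> |c A| \<le>o r \<and> good (c A)" using * by (auto simp: Fpow_def)
  next
    fix A B assume "B \<in> Fpow Z" "A \<subseteq> B"
    then show "c A \<subseteq> c B" using *[of B] by (cases "A = B") (auto simp: Fpow_def)
  qed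
qed

section \<open>Complete ultrafilters\<close>

lemma complete_filter_eventually_ball:
  assumes U: "complete_filter \<kappa> U" and X: "|X| <o \<kappa>" and P: "\<And>x. x \<in> X \<Longrightarrow> \<forall>\<^sub>F s in U. P x s"
  shows "\<forall>\<^sub>F s in U. \<forall>x\<in>X. P x s"
proof -
  have "|(\<lambda>x. {s. P x s}) ` X| <o \<kappa>" using card_of_image X by (rule ordLeq_ordLess_trans)
  then have "\<forall>\<^sub>F s in U. s \<in> \<Inter> ((\<lambda>x. {s. P x s}) ` X)"
    using U P unfolding complete_filter_def by (elim allE impE) auto
  then show ?thesis by (rule eventually_mono) auto
qed

lemma ultrafilter_not_eventually:
  assumes "ultrafilter U"
  shows "(\<not> (\<forall>\<^sub>F s in U. P s)) \<longleftrightarrow> (\<forall>\<^sub>F s in U. \<not> P s)"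
proof
  assume "\<forall>\<^sub>F s in U. \<not> P s"
  show "\<not> (\<forall>\<^sub>F s in U. P s)"
  proof
    assume "\<forall>\<^sub>F s in U. P s"
    with \<open>\<forall>\<^sub>F s in U. \<not> P s\<close> have "\<forall>\<^sub>F s in U. False" by eventually_elim simp
    then show False using assms by (simp add: ultrafilter_def eventually_False)
  qed
qed (use assms in \<open>auto simp: ultrafilter_def\<close>)

text \<open>Turns a witness that depends on \<open>s\<close> into a fixed one: otherwise fewer than
  \<kappa> null sets would cover almost everything.\<close>

lemma ultrafilter_eventually_bex:
  assumes "ultrafilter U" "complete_filter \<kappa> U" "|X| <o \<kappa>" "\<forall>\<^sub>F s in U. \<exists>x\<in>X. P x s"
  shows "\<exists>x\<in>X. \<forall>\<^sub>F s in U. P x s"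
proof (rule ccontr)
  assume "\<not> ?thesis"
  then have "\<forall>\<^sub>F s in U. \<forall>x\<in>X. \<not> P x s"
    using assms(1) by (intro complete_filter_eventually_ball[OF assms(2,3)])
      (auto simp: ultrafilter_not_eventually)
  with assms(4) have "\<forall>\<^sub>F s in U. False" by eventually_elim auto
  then show False using assms(1) by (simp add: ultrafilter_def eventually_False)
qed

lemma strongly_compact_ultrafilter:
  fixes \<F> :: "'i set set"
  assumes sc: "strongly_compact TYPE('i) \<kappa>" and \<kappa>: "Cinfinite \<kappa>"
    and Inter: "\<And>\<S>. |\<S>| <o \<kappa> \<Longrightarrow> \<S> \<subseteq> \<F> \<Longrightarrow> \<Inter>\<S> \<in> \<F>"
    and up: "\<And>A B. A \<in> \<F> \<Longrightarrow> A \<subseteq> B \<Longrightarrow> B \<in> \<F>" and ne: "{} \<notin> \<F>"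
  obtains U where "ultrafilter U" "complete_filter \<kappa> U" "\<forall>S\<in>\<F>. \<forall>\<^sub>F x in U. x \<in> S"
proof -
  define F where "F = Abs_filter (\<lambda>P. {x. P x} \<in> \<F>)"
  have fin: "|X :: 'i set set| <o \<kappa>" if "finite X" for X
    using that \<kappa> by (rule finite_ordLess_Cinfinite)
  have "is_filter (\<lambda>P. {x. P x} \<in> \<F>)"
  proof
    show "{x. True} \<in> \<F>" using Inter[of "{}"] fin by simp
  next
    fix P Q assume "{x. P x} \<in> \<F>" "{x. Q x} \<in> \<F>"
    then show "{x. P x \<and> Q x} \<in> \<F>"
      using Inter[of "{{x. P x}, {x. Q x}}"] fin by (simp add: Collect_conj_eq)
  next
    fix P Q assume "\<forall>x. P x \<longrightarrow> Q x" "{x. P x} \<in> \<F>"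
    then show "{x. Q x} \<in> \<F>" using up[of "{x. P x}" "{x. Q x}"] by blast
  qed
  then have ev: "eventually P F \<longleftrightarrow> {x. P x} \<in> \<F>" for P
    unfolding F_def by (rule eventually_Abs_filter)
  have "complete_filter \<kappa> F"
    unfolding complete_filter_def ev Collect_mem_eq using Inter by blast
  moreover have "F \<noteq> bot" using ev[of "\<lambda>_. False"] ne by (auto simp: eventually_False)
  moreover have "F \<le> principal UNIV" by simp
  ultimately obtain U where U: "U \<le> F" "ultrafilter U" "complete_filter \<kappa> U"
    using sc unfolding strongly_compact_def by blast
  show thesis
    by (rule that[OF U(2,3)]) (use U(1) ev in \<open>simp add: le_filter_def\<close>)
qed

text \<open>Regularity. If \<open>\<kappa>\<close> were singular, a \<open>\<kappa>\<close>-complete ultrafilter would be closed under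
  intersections of \<open>\<kappa>\<close> sets; one on the subsets of a set of size at least \<open>\<kappa>\<close> that avoids
  all singletons would then decide membership of every point at once, hence contain a singleton.\<close>

lemma strongly_compact_UN:
  fixes \<kappa> :: "'k rel" and \<A> :: "'a set set"
  assumes sc: "strongly_compact TYPE('a set) \<kappa>" and \<kappa>: "Cinfinite \<kappa>"
    and \<A>: "|\<A>| <o \<kappa>" "\<forall>A\<in>\<A>. |A| <o \<kappa>"
  shows "|\<Union>\<A>| <o \<kappa>"
proof (rule ccontr)
  assume "\<not> ?thesis"
  then have big: "\<kappa> \<le>o |\<Union>\<A>|" using \<kappa> by (simp add: not_ordLess_iff_ordLeq card_of_Well_order card_order_on_def)
  \<comment> \<open>Subsets of \<open>\<Union>\<A>\<close> are used rather than points because there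
    are strictly more than \<kappa> of them, so that complements of sets of size at most \<kappa>
    form a proper filter. Its \<kappa>-completeness needs only that fewer than \<kappa> sets of size
    at most \<kappa> have a union of size at most \<kappa>, which holds for singular \<kappa> as
    well.\<close>
  define \<F> where "\<F> = {S. |Pow (\<Union>\<A>) - S| \<le>o \<kappa>}"
  have Inter: "\<Inter>\<S> \<in> \<F>" if S: "|\<S>| <o \<kappa>" "\<S> \<subseteq> \<F>" for \<S>
  proof -
    have "|\<Union>S\<in>\<S>. Pow (\<Union>\<A>) - S| \<le>o \<kappa>"
      by (rule UNION_Cinfinite_bound[OF ordLess_imp_ordLeq[OF S(1)] _ \<kappa>]) (use S(2) in \<open>auto simp: \<F>_def\<close>)
    moreover have "Pow (\<Union>\<A>) - \<Inter>\<S> = (\<Union>S\<in>\<S>. Pow (\<Union>\<A>) - S)" by auto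
    ultimately show "\<Inter>\<S> \<in> \<F>" unfolding \<F>_def mem_Collect_eq by (simp only:)
  qed
  have up: "T \<in> \<F>" if ST: "S \<in> \<F>" "S \<subseteq> T" for S T
  proof -
    have "|Pow (\<Union>\<A>) - T| \<le>o |Pow (\<Union>\<A>) - S|" by (rule card_of_mono1) (use ST(2) in auto)
    then show "T \<in> \<F>" using ST(1) unfolding \<F>_def mem_Collect_eq by (rule ordLeq_transitive)
  qed
  have ne: "{} \<notin> \<F>"
  proof -
    have "\<kappa> <o |Pow (\<Union>\<A>)|" using big card_of_Pow ordLeq_ordLess_trans by blast
    then show "{} \<notin> \<F>" by (simp add: \<F>_def not_ordLess_ordLeq)
  qed
  obtain U where U: "ultrafilter U" "complete_filter \<kappa> U" "\<forall>S\<in>\<F>. \<forall>\<^sub>F x in U. x \<in> S"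
    by (rule strongly_compact_ultrafilter[OF sc \<kappa> Inter up ne])
  define m where "m = {a \<in> \<Union>\<A>. \<forall>\<^sub>F X in U. a \<in> X}"
  \<comment> \<open>Completeness is applied twice, inside each \<open>A\<close> and over
    \<open>\<A>\<close>. This settles all points of the union at once although there are at least
    \<kappa> of them, and forces \<open>X = m\<close> for almost every subset
    \<open>X\<close>.\<close>
  have "\<forall>\<^sub>F X in U. \<forall>A\<in>\<A>. \<forall>a\<in>A. a \<in> X \<longleftrightarrow> a \<in> m"
  proof (intro complete_filter_eventually_ball[OF U(2)])
    fix A a assume a: "A \<in> \<A>" "a \<in> A"
    show "\<forall>\<^sub>F X in U. a \<in> X \<longleftrightarrow> a \<in> m"
    proof (cases "a \<in> m")
      case False
      have "\<forall>\<^sub>F X in U. a \<notin> X"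
        by (rule iffD1[OF ultrafilter_not_eventually[OF U(1)]]) (use False a in \<open>auto simp: m_def\<close>)
      then show ?thesis using False by simp
    qed (simp add: m_def)
  qed (use \<A> in auto)
  moreover have "\<forall>\<^sub>F X in U. X \<in> Pow (\<Union>\<A>)"
    by (rule U(3)[rule_format]) (use Card_order_empty[of \<kappa>] \<kappa> in \<open>simp add: \<F>_def\<close>)
  moreover have "\<forall>\<^sub>F X in U. X \<in> - {m}"
  proof (rule U(3)[rule_format])
    have "Pow (\<Union>\<A>) - - {m} = {m}" by (auto simp: m_def)
    moreover have "|{m}| \<le>o \<kappa>" using finite_ordLess_Cinfinite[OF _ \<kappa>] ordLess_imp_ordLeq by blast
    ultimately show "- {m} \<in> \<F>" by (simp add: \<F>_def)
  qed
  ultimately have "\<forall>\<^sub>F X in U. False"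
  proof eventually_elim
    case (elim X)
    then have "X = m" by (auto simp: m_def)
    then show False using elim by simp
  qed
  then show False using U(1) by (simp add: ultrafilter_def eventually_False)
qed

text \<open>The cones of all \<open>s\<close> of size below \<kappa> above a given small
  \<open>A\<close> generate a filter. It is \<kappa>-complete because fewer than \<kappa> small sets
  have a small union, by \<open>strongly_compact_UN\<close>, and proper because \<open>A\<close>
  belongs to its own cone.\<close>

lemma strongly_compact_fine_ultrafilter:
  fixes \<kappa> :: "'k rel"
  assumes sc: "strongly_compact TYPE('a set) \<kappa>" and \<kappa>: "Cinfinite \<kappa>"
  obtains U :: "'a set filter" where "ultrafilter U" "complete_filter \<kappa> U"
    "\<forall>\<^sub>F s in U. |s| <o \<kappa>" "\<forall>x. \<forall>\<^sub>F s in U. x \<in> s"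
proof -
  define \<F> :: "'a set set set" where "\<F> = {S. \<exists>A. |A| <o \<kappa> \<and> {s. A \<subseteq> s \<and> |s| <o \<kappa>} \<subseteq> S}"
  have fin: "|X| <o \<kappa>" if "finite X" for X
    using that \<kappa> by (rule finite_ordLess_Cinfinite)
  have Inter: "\<Inter>\<S> \<in> \<F>" if S: "|\<S>| <o \<kappa>" "\<S> \<subseteq> \<F>" for \<S>
  proof -
    from S(2) have "\<forall>S\<in>\<S>. \<exists>A. |A| <o \<kappa> \<and> {s. A \<subseteq> s \<and> |s| <o \<kappa>} \<subseteq> S" by (auto simp: \<F>_def)
    from bchoice[OF this] obtain A
      where A: "\<And>S. S \<in> \<S> \<Longrightarrow> |A S| <o \<kappa> \<and> {s. A S \<subseteq> s \<and> |s| <o \<kappa>} \<subseteq> S"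
      by blast
    have "|\<Union> (A ` \<S>)| <o \<kappa>"
      using A ordLeq_ordLess_trans[OF card_of_image S(1)] by (intro strongly_compact_UN[OF sc \<kappa>]) auto
    moreover have "{s. \<Union> (A ` \<S>) \<subseteq> s \<and> |s| <o \<kappa>} \<subseteq> \<Inter>\<S>" using A by fastforce
    ultimately show "\<Inter>\<S> \<in> \<F>" unfolding \<F>_def by blast
  qed
  have up: "T \<in> \<F>" if "S \<in> \<F>" "S \<subseteq> T" for S T
    using that unfolding \<F>_def by blast
  have ne: "{} \<notin> \<F>" by (auto simp: \<F>_def)
  obtain U where U: "ultrafilter U" "complete_filter \<kappa> U" "\<forall>S\<in>\<F>. \<forall>\<^sub>F x in U. x \<in> S"
    by (rule strongly_compact_ultrafilter[OF sc \<kappa> Inter up ne])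
  show thesis
  proof (rule that[OF U(1,2)])
    have "{s. |s| <o \<kappa>} \<in> \<F>" using fin[of "{}"] by (auto simp: \<F>_def)
    from U(3)[rule_format, OF this] show "\<forall>\<^sub>F s in U. |s| <o \<kappa>" by simp
    have "{s. x \<in> s} \<in> \<F>" for x using fin[of "{x}"] by (auto simp: \<F>_def intro!: exI[of _ "{x}"])
    from U(3)[rule_format, OF this] show "\<forall>x. \<forall>\<^sub>F s in U. x \<in> s" by simp
  qed
qed

section \<open>Hulls in ultraproducts\<close>

text \<open>Phrased as one eventual equivalence so that completeness can intersect it over fewer
  than \<kappa> statements; in this way a single \<open>s\<close> decides a whole atomic
  diagram.\<close>

lemma ultrafilter_eventually_iff:
  assumes "ultrafilter U"
  shows "\<forall>\<^sub>F s in U. P s \<longleftrightarrow> (\<forall>\<^sub>F s in U. P s)"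
proof (cases "\<forall>\<^sub>F s in U. P s")
  case False
  then have "\<forall>\<^sub>F s in U. \<not> P s" using ultrafilter_not_eventually[OF assms] by blast
  then show ?thesis by (rule eventually_mono) (simp add: False)
qed simp

context abstract_elementary_class
begin

lemma LS_Cinfinite: "Cinfinite LS"
  using LS_bound cinfinite_mono[OF _ natLeq_cinfinite] by (auto simp: LS_bound_def)

lemma sub_induced_mono:
  assumes "sub (induced \<tau> N X) N" "sub (induced \<tau> N Y) N" "X \<subseteq> Y"
  shows "sub (induced \<tau> N X) (induced \<tau> N Y)"
proof (rule coherence[OF assms(1,2)])
  show "substructure \<tau> (induced \<tau> N X) (induced \<tau> N Y)"
    using sub_closed_in[OF assms(1)] sub_closed_in[OF assms(2)] assms
    by (intro substructure_inducedI) (auto dest: sub_models structures)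
qed

lemma small_strong_superset:
  assumes "M \<in> K" "A \<subseteq> univ M" "|A| \<le>o LS"
  shows "\<exists>X. A \<subseteq> X \<and> X \<subseteq> univ M \<and> |X| \<le>o LS \<and> sub (induced \<tau> M X) M"
proof -
  obtain M' where M': "A \<subseteq> univ M'" "sub M' M" "|univ M'| \<le>o |A| +c LS"
    using LS_bound assms(1,2) unfolding LS_bound_def by blast
  have "|univ M'| \<le>o LS"
    using M'(3) csum_absorb2[OF LS_Cinfinite assms(3)] by (rule ordLeq_ordIso_trans)
  then show ?thesis using M' sub_induced[OF M'(2)] sub_univ[OF M'(2)] by metis
qed

text \<open>Restricting the isomorphism to \<open>X\<close> reduces this to invariance of strong
  inclusion under isomorphism; transitivity leads from the image of \<open>M\<close> on to
  \<open>N\<close>.\<close>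

lemma K_embedding_strong_image:
  assumes e: "K_embedding \<tau> sub e M N" and X: "sub (induced \<tau> M X) M"
  shows "sub (induced \<tau> N (e ` X)) N"
proof -
  obtain N' where N': "sub N' N" "isomorphism \<tau> e M N'" using e by (auto simp: K_embedding_def)
  have X': "closed_in \<tau> M X" using sub_closed_in[OF X] by simp
  note iso = isomorphism_induced_subset[OF N'(2) X']
  have N'': "is_structure \<tau> N'" using N'(1) sub_models structures by blast
  have "substructure \<tau> (induced \<tau> N' (e ` X)) N'"
    using N'' iso(1) by (rule substructure_induced)
  then have "sub (induced \<tau> N' (e ` X)) N'"
    using sub_iso_closed[OF X N'(2) _ iso(2)] by blast
  moreover have "induced \<tau> N' (e ` X) = induced \<tau> N (e ` X)"
    using induced_induced[of "e ` X" "univ N'" \<tau> N] sub_induced[OF N'(1)] iso(1)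
    by (simp add: closed_in_def)
  ultimately show ?thesis using sub_trans[OF _ N'(1)] by simp
qed

end

text \<open>The set \<open>T\<close> of choice functions generated by \<open>Q\<close> represents a Skolem hull inside the
  ultraproduct of the \<open>N s\<close>. The ultraproduct itself may be too large for the type \<open>'a\<close>, the
  hull is not; \<open>\<pi>\<close> maps it into \<open>'a\<close>, identifying functions that agree modulo \<open>U\<close>.\<close>

locale ultraproduct_hull = abstract_elementary_class \<tau> K sub LS
  for \<tau> :: "('f, 'r) vocabulary"
    and K :: "('a, 'f, 'r) fo_structure set"
    and sub :: "('a, 'f, 'r) fo_structure \<Rightarrow> ('a, 'f, 'r) fo_structure \<Rightarrow> bool"
    and LS :: "'l rel" +
  fixes \<kappa> :: "'k rel" and U :: "'i filter" and N :: "'i \<Rightarrow> ('a, 'f, 'r) fo_structure"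
    and Q :: "('i \<Rightarrow> 'a) set" and c :: "('i \<Rightarrow> 'a) set \<Rightarrow> ('i \<Rightarrow> 'a) set"
    and \<pi> :: "('i \<Rightarrow> 'a) \<Rightarrow> 'a"
  assumes U: "ultrafilter U" "complete_filter \<kappa> U"
    and LS_less: "LS <o \<kappa>"
    and Q: "|Q| \<le>o |UNIV :: 'a set|"
    and c_superset: "A \<in> Fpow Q \<Longrightarrow> A \<subseteq> c A"
    and c_small: "A \<in> Fpow Q \<Longrightarrow> |c A| \<le>o LS"
    and c_strong: "A \<in> Fpow Q \<Longrightarrow>
      \<forall>\<^sub>F s in U. sub (induced \<tau> (N s) ((\<lambda>t. t s) ` c A)) (N s)"
    and c_mono: "B \<in> Fpow Q \<Longrightarrow> A \<subseteq> B \<Longrightarrow> c A \<subseteq> c B"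
    and \<pi>: "t \<in> (\<Union>A\<in>Fpow Q. c A) \<Longrightarrow> u \<in> (\<Union>A\<in>Fpow Q. c A) \<Longrightarrow>
      \<pi> t = \<pi> u \<longleftrightarrow> (\<forall>\<^sub>F s in U. t s = u s)"
begin

definition T :: "('i \<Rightarrow> 'a) set" where "T = (\<Union>A\<in>Fpow Q. c A)"

definition strong :: "('i \<Rightarrow> 'a) set \<Rightarrow> bool" where
  "strong B \<longleftrightarrow> (\<forall>\<^sub>F s in U. sub (induced \<tau> (N s) ((\<lambda>t. t s) ` B)) (N s))"

text \<open>The definite description has a value by \<open>T_closed\<close>, and only one because
  \<open>map_\<pi>_eq\<close> makes any two representatives of \<open>xs\<close> agree almost
  everywhere.\<close>

definition H :: "('a, 'f, 'r) fo_structure" where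
  "H = \<lparr> univ = \<pi> ` T,
     fun_int = (\<lambda>f. if f \<in> Funs \<tau>
       then restrict (\<lambda>xs. THE y. \<exists>ts\<in>tuples T (fun_arity \<tau> f). \<exists>t\<in>T. map \<pi> ts = xs \<and> y = \<pi> t \<and>
              (\<forall>\<^sub>F s in U. t s = fun_int (N s) f (map (\<lambda>t. t s) ts)))
            (tuples (\<pi> ` T) (fun_arity \<tau> f))
       else (\<lambda>_. undefined)),
     rel_int = (\<lambda>R. if R \<in> Rels \<tau>
       then {map \<pi> ts | ts. ts \<in> tuples T (rel_arity \<tau> R) \<and>
              (\<forall>\<^sub>F s in U. map (\<lambda>t. t s) ts \<in> rel_int (N s) R)}
       else {}) \<rparr>"

lemma univ_H [simp]: "univ H = \<pi> ` T"
  by (simp add: H_def)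

section \<open>Atomic formulas in the hull\<close>

lemma Q_subset_T: "Q \<subseteq> T"
proof
  fix t assume "t \<in> Q"
  then have "{t} \<in> Fpow Q" by (simp add: Fpow_def)
  then show "t \<in> T" using c_superset[of "{t}"] by (auto simp: T_def)
qed

lemma \<pi>_iff: "t \<in> T \<Longrightarrow> u \<in> T \<Longrightarrow> \<pi> t = \<pi> u \<longleftrightarrow> (\<forall>\<^sub>F s in U. t s = u s)"
  using \<pi> by (simp add: T_def)

lemma small_ball:
  assumes "|X| \<le>o LS" "\<And>x. x \<in> X \<Longrightarrow> \<forall>\<^sub>F s in U. P x s"
  shows "\<forall>\<^sub>F s in U. \<forall>x\<in>X. P x s"
  using complete_filter_eventually_ball[OF U(2) ordLeq_ordLess_trans[OF assms(1) LS_less]] assms(2)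
  by blast

lemma map_\<pi>_eq:
  assumes "set ts \<subseteq> T" "set us \<subseteq> T" "map \<pi> ts = map \<pi> us"
  shows "\<forall>\<^sub>F s in U. map (\<lambda>t. t s) ts = map (\<lambda>t. t s) us"
  using assms
proof (induction ts arbitrary: us)
  case (Cons t ts)
  then obtain u vs where us: "us = u # vs" by (cases us) auto
  have "\<forall>\<^sub>F s in U. t s = u s" using Cons.prems us \<pi>_iff by auto
  moreover have "\<forall>\<^sub>F s in U. map (\<lambda>t. t s) ts = map (\<lambda>t. t s) vs" using Cons us by auto
  ultimately show ?case by eventually_elim (simp add: us)
qed simp

lemma rel_int_H:
  assumes "R \<in> Rels \<tau>" "ts \<in> tuples T (rel_arity \<tau> R)"
  shows "map \<pi> ts \<in> rel_int H R \<longleftrightarrow> (\<forall>\<^sub>F s in U. map (\<lambda>t. t s) ts \<in> rel_int (N s) R)"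
proof
  assume "map \<pi> ts \<in> rel_int H R"
  then obtain us where us: "us \<in> tuples T (rel_arity \<tau> R)" "map \<pi> ts = map \<pi> us"
    "\<forall>\<^sub>F s in U. map (\<lambda>t. t s) us \<in> rel_int (N s) R"
    using assms by (auto simp: H_def)
  have "\<forall>\<^sub>F s in U. map (\<lambda>t. t s) ts = map (\<lambda>t. t s) us"
    using map_\<pi>_eq us assms by (auto simp: tuples_def)
  with us(3) show "\<forall>\<^sub>F s in U. map (\<lambda>t. t s) ts \<in> rel_int (N s) R" by eventually_elim simp
qed (use assms in \<open>auto simp: H_def\<close>)

text \<open>By monotonicity all entries of \<open>ts\<close> lie in one \<open>c A\<close>. Its
  evaluation is closed in almost every \<open>N s\<close>, so the value is attained there by some
  member of \<open>c A\<close> depending on \<open>s\<close>; as \<open>c A\<close> has size below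
  \<kappa>, one member works almost everywhere.\<close>

lemma T_closed:
  assumes f: "f \<in> Funs \<tau>" and ts: "ts \<in> tuples T (fun_arity \<tau> f)"
  obtains t where "t \<in> T" "\<forall>\<^sub>F s in U. t s = fun_int (N s) f (map (\<lambda>t. t s) ts)"
proof -
  obtain A where A: "A \<in> Fpow Q" "set ts \<subseteq> c A"
    using finite_subset_directed_union[of "set ts" c Q] c_mono ts by (auto simp: tuples_def T_def)
  have "\<forall>\<^sub>F s in U. \<exists>t\<in>c A. t s = fun_int (N s) f (map (\<lambda>t. t s) ts)"
    using c_strong[OF A(1)]
  proof eventually_elim
    case (elim s)
    have "map (\<lambda>t. t s) ts \<in> tuples ((\<lambda>t. t s) ` c A) (fun_arity \<tau> f)"
      using A(2) ts by (auto simp: tuples_def)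
    then have "fun_int (N s) f (map (\<lambda>t. t s) ts) \<in> (\<lambda>t. t s) ` c A"
      using sub_closed_in[OF elim] f by (simp add: closed_in_def)
    then show ?case by auto
  qed
  from ultrafilter_eventually_bex[OF U ordLeq_ordLess_trans[OF c_small[OF A(1)] LS_less] this]
  show thesis using that A(1) by (auto simp: T_def)
qed

lemma fun_int_H:
  assumes f: "f \<in> Funs \<tau>" and ts: "ts \<in> tuples T (fun_arity \<tau> f)" and t: "t \<in> T"
  shows "fun_int H f (map \<pi> ts) = \<pi> t \<longleftrightarrow>
    (\<forall>\<^sub>F s in U. t s = fun_int (N s) f (map (\<lambda>t. t s) ts))"
proof -
  obtain u where u: "u \<in> T" "\<forall>\<^sub>F s in U. u s = fun_int (N s) f (map (\<lambda>t. t s) ts)"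
    using T_closed[OF f ts] .
  have "map \<pi> ts \<in> tuples (\<pi> ` T) (fun_arity \<tau> f)" using ts by (rule map_in_tuples) simp
  then have "fun_int H f (map \<pi> ts) =
    (THE y. \<exists>us\<in>tuples T (fun_arity \<tau> f). \<exists>t\<in>T. map \<pi> us = map \<pi> ts \<and> y = \<pi> t \<and>
       (\<forall>\<^sub>F s in U. t s = fun_int (N s) f (map (\<lambda>t. t s) us)))"
    using f by (simp add: H_def)
  also have "\<dots> = \<pi> u"
  proof (rule the_equality)
    fix y assume "\<exists>us\<in>tuples T (fun_arity \<tau> f). \<exists>t\<in>T. map \<pi> us = map \<pi> ts \<and> y = \<pi> t \<and>
       (\<forall>\<^sub>F s in U. t s = fun_int (N s) f (map (\<lambda>t. t s) us))"
    then obtain us v where us: "us \<in> tuples T (fun_arity \<tau> f)" "map \<pi> us = map \<pi> ts" "v \<in> T" "y = \<pi> v"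
       "\<forall>\<^sub>F s in U. v s = fun_int (N s) f (map (\<lambda>t. t s) us)" by blast
    have "\<forall>\<^sub>F s in U. map (\<lambda>t. t s) us = map (\<lambda>t. t s) ts"
      using map_\<pi>_eq us ts by (auto simp: tuples_def)
    with us(5) u(2) have "\<forall>\<^sub>F s in U. v s = u s" by eventually_elim simp
    then show "y = \<pi> u" using us u \<pi>_iff by simp
  qed (use u ts in blast)
  finally have "fun_int H f (map \<pi> ts) = \<pi> t \<longleftrightarrow> (\<forall>\<^sub>F s in U. u s = t s)" using \<pi>_iff u t by simp
  also have "\<dots> \<longleftrightarrow> (\<forall>\<^sub>F s in U. t s = fun_int (N s) f (map (\<lambda>t. t s) ts))"
  proof
    assume "\<forall>\<^sub>F s in U. u s = t s"
    with u(2) show "\<forall>\<^sub>F s in U. t s = fun_int (N s) f (map (\<lambda>t. t s) ts)" by eventually_elim simp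
  next
    assume "\<forall>\<^sub>F s in U. t s = fun_int (N s) f (map (\<lambda>t. t s) ts)"
    with u(2) show "\<forall>\<^sub>F s in U. u s = t s" by eventually_elim simp
  qed
  finally show ?thesis .
qed

text \<open>Holds even for empty \<open>Q\<close>: \<open>c {}\<close> evaluates to the universe of
  a structure at almost every \<open>s\<close>.\<close>

lemma T_nonempty: "T \<noteq> {}"
proof
  assume "T = {}"
  then have "c {} = {}" using empty_in_Fpow by (auto simp: T_def)
  then have "\<forall>\<^sub>F s in U. sub (induced \<tau> (N s) {}) (N s)" using c_strong[OF empty_in_Fpow] by simp
  then have "\<forall>\<^sub>F s in U. False"
    by (rule eventually_mono) (auto dest: sub_closed_in simp: closed_in_def)
  then show False using U(1) by (simp add: ultrafilter_def eventually_False)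
qed

lemma is_structure_H: "is_structure \<tau> H"
  unfolding is_structure_def
proof (intro conjI ballI allI impI)
  show "univ H \<noteq> {}" using T_nonempty by simp
next
  fix f assume f: "f \<in> Funs \<tau>"
  show "fun_int H f \<in> tuples (univ H) (fun_arity \<tau> f) \<rightarrow>\<^sub>E univ H"
  proof (rule PiE_I)
    fix xs assume "xs \<in> tuples (univ H) (fun_arity \<tau> f)"
    then obtain ts where ts: "ts \<in> tuples T (fun_arity \<tau> f)" "xs = map \<pi> ts"
      unfolding univ_H by (elim in_tuples_imageE)
    obtain t where t: "t \<in> T" "\<forall>\<^sub>F s in U. t s = fun_int (N s) f (map (\<lambda>t. t s) ts)"
      using T_closed[OF f ts(1)] .
    then have "fun_int H f xs = \<pi> t" using fun_int_H[OF f ts(1) t(1)] ts by simp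
    then show "fun_int H f xs \<in> univ H" using t by simp
  qed (use f in \<open>simp add: H_def\<close>)
qed (fastforce simp: H_def tuples_def)+

text \<open>A set \<open>C\<close> of at most \<open>LS\<close> functions has an atomic diagram of size at most \<open>LS\<close>, so by
  completeness evaluation at almost every \<open>s\<close> is an isomorphism from its image under \<open>\<pi>\<close>.\<close>

lemma strong_transfer:
  assumes BC: "B \<subseteq> C" and CT: "C \<subseteq> T" and C: "|C| \<le>o LS" and strong: "strong B" "strong C"
  shows "sub (induced \<tau> H (\<pi> ` B)) (induced \<tau> H (\<pi> ` C))"
proof -
  have lists: "|lists C| \<le>o LS" using card_of_lists[OF C LS_Cinfinite] .
  have voc: "|Funs \<tau>| \<le>o LS" "|Rels \<tau>| \<le>o LS" using LS_bound by (auto simp: LS_bound_def)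
  have "\<forall>\<^sub>F s in U. \<forall>t\<in>C. \<forall>u\<in>C. t s = u s \<longleftrightarrow> \<pi> t = \<pi> u"
  proof (intro small_ball[OF C])
    fix t u assume "t \<in> C" "u \<in> C"
    then show "\<forall>\<^sub>F s in U. t s = u s \<longleftrightarrow> \<pi> t = \<pi> u"
      using ultrafilter_eventually_iff[OF U(1), of "\<lambda>s. t s = u s"] \<pi>_iff CT by (simp add: subset_iff)
  qed
  moreover have "\<forall>\<^sub>F s in U. \<forall>f\<in>Funs \<tau>. \<forall>ts\<in>lists C. \<forall>t\<in>C. ts \<in> tuples C (fun_arity \<tau> f) \<longrightarrow>
      (t s = fun_int (N s) f (map (\<lambda>t. t s) ts) \<longleftrightarrow> fun_int H f (map \<pi> ts) = \<pi> t)"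
  proof (intro small_ball[OF C] small_ball[OF lists] small_ball[OF voc(1)])
    fix f ts t assume *: "f \<in> Funs \<tau>" "ts \<in> lists C" "t \<in> C"
    show "\<forall>\<^sub>F s in U. ts \<in> tuples C (fun_arity \<tau> f) \<longrightarrow>
      (t s = fun_int (N s) f (map (\<lambda>t. t s) ts) \<longleftrightarrow> fun_int H f (map \<pi> ts) = \<pi> t)"
    proof (cases "ts \<in> tuples C (fun_arity \<tau> f)")
      case True
      then have "ts \<in> tuples T (fun_arity \<tau> f)" using tuples_mono[OF CT] by blast
      then show ?thesis
        using ultrafilter_eventually_iff[OF U(1), of "\<lambda>s. t s = fun_int (N s) f (map (\<lambda>t. t s) ts)"]
          fun_int_H[of f ts t] * CT by (simp add: subset_iff)
    qed simp
  qed
  moreover have "\<forall>\<^sub>F s in U. \<forall>R\<in>Rels \<tau>. \<forall>ts\<in>lists C. ts \<in> tuples C (rel_arity \<tau> R) \<longrightarrow>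
      (map (\<lambda>t. t s) ts \<in> rel_int (N s) R \<longleftrightarrow> map \<pi> ts \<in> rel_int H R)"
  proof (intro small_ball[OF lists] small_ball[OF voc(2)])
    fix R ts assume *: "R \<in> Rels \<tau>" "ts \<in> lists C"
    show "\<forall>\<^sub>F s in U. ts \<in> tuples C (rel_arity \<tau> R) \<longrightarrow>
      (map (\<lambda>t. t s) ts \<in> rel_int (N s) R \<longleftrightarrow> map \<pi> ts \<in> rel_int H R)"
    proof (cases "ts \<in> tuples C (rel_arity \<tau> R)")
      case True
      then have "ts \<in> tuples T (rel_arity \<tau> R)" using tuples_mono[OF CT] by blast
      then show ?thesis
        using ultrafilter_eventually_iff[OF U(1), of "\<lambda>s. map (\<lambda>t. t s) ts \<in> rel_int (N s) R"]
          rel_int_H[of R ts] * by simp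
    qed simp
  qed
  moreover note strong[unfolded strong_def]
  ultimately have "\<forall>\<^sub>F s in U. (\<forall>t\<in>C. \<forall>u\<in>C. t s = u s \<longleftrightarrow> \<pi> t = \<pi> u) \<and>
     (\<forall>f\<in>Funs \<tau>. \<forall>ts\<in>lists C. \<forall>t\<in>C. ts \<in> tuples C (fun_arity \<tau> f) \<longrightarrow>
      (t s = fun_int (N s) f (map (\<lambda>t. t s) ts) \<longleftrightarrow> fun_int H f (map \<pi> ts) = \<pi> t)) \<and>
     (\<forall>R\<in>Rels \<tau>. \<forall>ts\<in>lists C. ts \<in> tuples C (rel_arity \<tau> R) \<longrightarrow>
      (map (\<lambda>t. t s) ts \<in> rel_int (N s) R \<longleftrightarrow> map \<pi> ts \<in> rel_int H R)) \<and>
     sub (induced \<tau> (N s) ((\<lambda>t. t s) ` B)) (N s) \<and> sub (induced \<tau> (N s) ((\<lambda>t. t s) ` C)) (N s)"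
    by eventually_elim blast
  moreover have "U \<noteq> bot" using U(1) by (simp add: ultrafilter_def)
  \<comment> \<open>This one \<open>s\<close> realises the atomic diagram of \<open>C\<close> and
    both strong inclusions; the rest of the argument compares \<open>H\<close> with
    \<open>N s\<close> alone.\<close>
  ultimately obtain s where s: "\<forall>t\<in>C. \<forall>u\<in>C. t s = u s \<longleftrightarrow> \<pi> t = \<pi> u"
     "\<forall>f\<in>Funs \<tau>. \<forall>ts\<in>lists C. \<forall>t\<in>C. ts \<in> tuples C (fun_arity \<tau> f) \<longrightarrow>
      (t s = fun_int (N s) f (map (\<lambda>t. t s) ts) \<longleftrightarrow> fun_int H f (map \<pi> ts) = \<pi> t)"
     "\<forall>R\<in>Rels \<tau>. \<forall>ts\<in>lists C. ts \<in> tuples C (rel_arity \<tau> R) \<longrightarrow>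
      (map (\<lambda>t. t s) ts \<in> rel_int (N s) R \<longleftrightarrow> map \<pi> ts \<in> rel_int H R)"
    and sB: "sub (induced \<tau> (N s) ((\<lambda>t. t s) ` B)) (N s)"
    and sC: "sub (induced \<tau> (N s) ((\<lambda>t. t s) ` C)) (N s)"
    using eventually_happens' by (smt (verit, best))
  have lists_C: "ts \<in> lists C" if "ts \<in> tuples C n" for ts n using that by (auto simp: tuples_def)
  have eq: "\<And>t u. t \<in> C \<Longrightarrow> u \<in> C \<Longrightarrow> t s = u s \<longleftrightarrow> \<pi> t = \<pi> u"
    and F: "\<And>f ts t. f \<in> Funs \<tau> \<Longrightarrow> ts \<in> tuples C (fun_arity \<tau> f) \<Longrightarrow> t \<in> C \<Longrightarrow>
      t s = fun_int (N s) f (map (\<lambda>t. t s) ts) \<longleftrightarrow> fun_int H f (map \<pi> ts) = \<pi> t"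
    and R: "\<And>R ts. R \<in> Rels \<tau> \<Longrightarrow> ts \<in> tuples C (rel_arity \<tau> R) \<Longrightarrow>
      map (\<lambda>t. t s) ts \<in> rel_int (N s) R \<longleftrightarrow> map \<pi> ts \<in> rel_int H R"
    using s lists_C by blast+
  let ?at = "\<lambda>B. (\<lambda>t. t s) ` B"
  \<comment> \<open>Inverts evaluation at \<open>s\<close> and then applies \<pi>. The choice of the
    preimage is immaterial by \<open>eq\<close>.\<close>
  define h where "h x = \<pi> (SOME t. t \<in> C \<and> t s = x)" for x
  have h: "h (t s) = \<pi> t" if "t \<in> C" for t
  proof -
    have "(SOME u. u \<in> C \<and> u s = t s) \<in> C \<and> (SOME u. u \<in> C \<and> u s = t s) s = t s"
      by (rule someI[of _ t]) (use that in simp)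
    then show ?thesis unfolding h_def using eq that by blast
  qed
  have hm: "map h (map (\<lambda>t. t s) ts) = map \<pi> ts" if "ts \<in> tuples C n" for ts n
    using that h by (auto simp: tuples_def)
  have himg: "h ` ?at B' = \<pi> ` B'" if "B' \<subseteq> C" for B'
    using h that by (force simp: image_image)
  have clC: "closed_in \<tau> (N s) (?at C)" using sub_closed_in[OF sC] by simp
  \<comment> \<open>\<open>F\<close> only tests candidate values taken from \<open>C\<close>;
    closedness of the evaluated set in \<open>N s\<close> supplies one that passes, and hence also
    closedness of the image of \<open>C\<close> in \<open>H\<close>.\<close>
  have Fat: "\<exists>t\<in>C. fun_int (N s) f (map (\<lambda>t. t s) ts) = t s \<and> fun_int H f (map \<pi> ts) = \<pi> t"
    if "f \<in> Funs \<tau>" "ts \<in> tuples C (fun_arity \<tau> f)" for f ts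
  proof -
    have "map (\<lambda>t. t s) ts \<in> tuples (?at C) (fun_arity \<tau> f)" using that(2) by (rule map_in_tuples) simp
    then have "fun_int (N s) f (map (\<lambda>t. t s) ts) \<in> ?at C"
      using clC that by (simp add: closed_in_def)
    then show ?thesis using F[OF that] by fastforce
  qed
  have clH: "closed_in \<tau> H (\<pi> ` C)"
    unfolding closed_in_def
  proof (intro conjI ballI)
    show "\<pi> ` C \<noteq> {}" using clC by (auto simp: closed_in_def)
    show "\<pi> ` C \<subseteq> univ H" using CT by auto
    fix f xs assume f: "f \<in> Funs \<tau>" and "xs \<in> tuples (\<pi> ` C) (fun_arity \<tau> f)"
    then obtain ts where "ts \<in> tuples C (fun_arity \<tau> f)" "xs = map \<pi> ts" by (elim in_tuples_imageE)
    then show "fun_int H f xs \<in> \<pi> ` C" using Fat[OF f] by fastforce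
  qed
  have iso: "isomorphism \<tau> h (induced \<tau> (N s) (?at C)) (induced \<tau> H (\<pi> ` C))"
    unfolding isomorphism_def
  proof (intro conjI ballI)
    show "is_structure \<tau> (induced \<tau> (N s) (?at C))" using sC sub_models structures by blast
    show "is_structure \<tau> (induced \<tau> H (\<pi> ` C))" using is_structure_induced[OF is_structure_H clH] .
    have "inj_on h (?at C)" using h eq by (auto simp: inj_on_def)
    then show "bij_betw h (univ (induced \<tau> (N s) (?at C))) (univ (induced \<tau> H (\<pi> ` C)))"
      using himg[of C] by (simp add: bij_betw_def)
  next
    fix f xs assume f: "f \<in> Funs \<tau>" and xs: "xs \<in> tuples (univ (induced \<tau> (N s) (?at C))) (fun_arity \<tau> f)"
    from xs obtain ts where ts: "ts \<in> tuples C (fun_arity \<tau> f)" "xs = map (\<lambda>t. t s) ts"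
      unfolding univ_induced by (elim in_tuples_imageE)
    have "map h xs \<in> tuples (\<pi> ` C) (fun_arity \<tau> f)"
      unfolding ts(2) hm[OF ts(1)] using ts(1) by (rule map_in_tuples) simp
    moreover obtain t where "t \<in> C" "fun_int (N s) f xs = t s" "fun_int H f (map h xs) = \<pi> t"
      using Fat[OF f ts(1)] unfolding ts(2) hm[OF ts(1)] by blast
    ultimately show "h (fun_int (induced \<tau> (N s) (?at C)) f xs) = fun_int (induced \<tau> H (\<pi> ` C)) f (map h xs)"
      using f xs h by (simp add: induced_def)
  next
    fix R' xs assume R': "R' \<in> Rels \<tau>" and xs: "xs \<in> tuples (univ (induced \<tau> (N s) (?at C))) (rel_arity \<tau> R')"
    from xs obtain ts where ts: "ts \<in> tuples C (rel_arity \<tau> R')" "xs = map (\<lambda>t. t s) ts"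
      unfolding univ_induced by (elim in_tuples_imageE)
    have "map h xs \<in> tuples (\<pi> ` C) (rel_arity \<tau> R')"
      unfolding ts(2) hm[OF ts(1)] using ts(1) by (rule map_in_tuples) simp
    moreover have "xs \<in> rel_int (N s) R' \<longleftrightarrow> map h xs \<in> rel_int H R'"
      using R[OF R' ts(1)] unfolding ts(2) hm[OF ts(1)] .
    ultimately show "xs \<in> rel_int (induced \<tau> (N s) (?at C)) R' \<longleftrightarrow> map h xs \<in> rel_int (induced \<tau> H (\<pi> ` C)) R'"
      using R' xs by (simp add: induced_def)
  qed
  have "K_embedding \<tau> sub h (induced \<tau> (N s) (?at C)) (induced \<tau> H (\<pi> ` C))"
    using iso iso_closed[OF _ iso] sub_models[OF sC] sub_refl by (auto simp: K_embedding_def)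
  \<comment> \<open>Coherence inside \<open>N s\<close> makes the evaluation of \<open>B\<close>
    strong in that of \<open>C\<close>; the embedding \<open>h\<close> then carries this to
    \<open>H\<close>.\<close>
  moreover have "sub (induced \<tau> (induced \<tau> (N s) (?at C)) (?at B)) (induced \<tau> (N s) (?at C))"
    using sub_induced_mono[OF sB sC] BC induced_induced[of "?at B" "?at C" \<tau> "N s"] by (simp add: image_mono)
  ultimately have "sub (induced \<tau> (induced \<tau> H (\<pi> ` C)) (h ` ?at B)) (induced \<tau> H (\<pi> ` C))"
    by (rule K_embedding_strong_image)
  then show ?thesis using himg[OF BC] induced_induced[of "\<pi> ` B" "\<pi> ` C" \<tau> H] BC by (simp add: image_mono)
qed

section \<open>Strong submodels of the hull\<close>

lemma Fpow_mem_mono: "B \<in> Fpow X \<Longrightarrow> A \<subseteq> B \<Longrightarrow> A \<in> Fpow X"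
  by (auto simp: Fpow_def intro: finite_subset)

lemma c_transfer:
  assumes "B \<in> Fpow Q" "A \<subseteq> B"
  shows "sub (induced \<tau> H (\<pi> ` c A)) (induced \<tau> H (\<pi> ` c B))"
  using assms Fpow_mem_mono[OF assms] c_mono c_small c_strong
  by (intro strong_transfer) (auto simp: T_def strong_def)

lemma H_eq: "induced \<tau> H (\<Union>A\<in>Fpow Q. \<pi> ` c A) = H"
  using induced_univ[OF is_structure_H] by (simp add: T_def image_UN)

lemma H_in_K: "H \<in> K"
  using directed_union(1)[of Q H "\<lambda>A. \<pi> ` c A", OF Q c_transfer] H_eq by simp

lemma c_strong_H: "A \<in> Fpow Q \<Longrightarrow> sub (induced \<tau> H (\<pi> ` c A)) H"
  using directed_union(2)[of Q H "\<lambda>A. \<pi> ` c A", OF Q c_transfer] H_eq by simp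

text \<open>\<open>strong_transfer\<close> compares only sets of size at most \<open>LS\<close>, and
  \<open>H\<close> may be larger, while \<open>Y\<close> need not be one of the \<open>c A\<close>.
  So \<open>Y\<close> is enlarged to \<open>?D\<close>, still of size at most \<open>LS\<close> and
  strong at almost every \<open>s\<close> by smoothness in \<open>N s\<close>. Then \<open>Y\<close>
  is strong in \<open>?D\<close> by transfer, and \<open>?D\<close> in \<open>H\<close> by
  smoothness in \<open>H\<close>.\<close>

lemma strong_image_H:
  assumes Y: "Y \<subseteq> Q" "|Y| \<le>o LS" "strong Y"
  shows "sub (induced \<tau> H (\<pi> ` Y)) H"
proof -
  let ?D = "\<Union>A\<in>Fpow Y. c A"
  have Fp: "Fpow Y \<subseteq> Fpow Q" using Fpow_mono[OF Y(1)] .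
  have FY: "|Fpow Y| \<le>o LS" using card_of_Fpow[OF Y(2) LS_Cinfinite] .
  have YU: "|Y| \<le>o |UNIV :: 'a set|" using card_of_mono1[OF Y(1)] Q ordLeq_transitive by blast
  have "\<forall>\<^sub>F s in U. \<forall>A\<in>Fpow Y. sub (induced \<tau> (N s) ((\<lambda>t. t s) ` c A)) (N s)"
    using c_strong Fp by (intro small_ball[OF FY]) blast
  then have "strong ?D"
    unfolding strong_def
  proof eventually_elim
    case (elim s)
    have "sub (induced \<tau> (N s) (\<Union>A\<in>Fpow Y. (\<lambda>t. t s) ` c A)) (N s)"
    proof (rule directed_union(3)[OF YU])
      fix A B assume "B \<in> Fpow Y" "A \<subseteq> B"
      then show "sub (induced \<tau> (N s) ((\<lambda>t. t s) ` c A)) (induced \<tau> (N s) ((\<lambda>t. t s) ` c B))"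
        using elim Fpow_mem_mono[of B Y A] c_mono[of B A] Fp
        by (intro sub_induced_mono image_mono) auto
    qed (use elim in auto)
    then show ?case by (simp add: image_UN)
  qed
  moreover have "Y \<subseteq> ?D"
  proof
    fix t assume "t \<in> Y"
    then have "{t} \<in> Fpow Y" by (simp add: Fpow_def)
    then show "t \<in> ?D" using c_superset[of "{t}"] Fp by auto
  qed
  moreover have "?D \<subseteq> T" using Fp by (auto simp: T_def)
  moreover have "|?D| \<le>o LS"
    using c_small Fp by (intro UNION_Cinfinite_bound[OF FY _ LS_Cinfinite]) blast
  ultimately have "sub (induced \<tau> H (\<pi> ` Y)) (induced \<tau> H (\<pi> ` ?D))"
    using Y(3) by (intro strong_transfer) auto
  moreover have "sub (induced \<tau> H (\<Union>A\<in>Fpow Y. \<pi> ` c A)) H"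
    using Fp c_transfer c_strong_H by (intro directed_union(3)[OF YU]) blast+
  ultimately show ?thesis using sub_trans by (simp add: image_UN)
qed

text \<open>Since \<open>M\<close> may be large, its image is treated as the directed union of the
  images of strong submodels of size at most \<open>LS\<close>. Each of these lies in almost every
  \<open>M' s\<close>, so its image is strong in almost every \<open>N s\<close>, as
  \<open>strong_image_H\<close> requires.\<close>

lemma K_embedding_H:
  assumes M: "M \<in> K"
    and sub_M: "\<forall>\<^sub>F s in U. sub (M' s) M"
    and emb: "\<forall>\<^sub>F s in U. K_embedding \<tau> sub (e s) (M' s) (N s)"
    and cover: "\<And>x. x \<in> univ M \<Longrightarrow> \<forall>\<^sub>F s in U. x \<in> univ (M' s)"
    and eQ: "\<And>x. x \<in> univ M \<Longrightarrow> (\<lambda>s. e s x) \<in> Q"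
  shows "K_embedding \<tau> sub (\<lambda>x. \<pi> (\<lambda>s. e s x)) M H"
proof -
  \<comment> \<open>Where \<open>x\<close> is outside \<open>M' s\<close> the value
    \<open>e s x\<close> is arbitrary; by \<open>cover\<close> this affects only a null set of
    \<open>s\<close>.\<close>
  let ?e = "\<lambda>x s. e s x"
  let ?g = "\<lambda>x. \<pi> (?e x)"
  have eT: "?e x \<in> T" if "x \<in> univ M" for x using eQ[OF that] Q_subset_T by blast
  have cover_small: "\<forall>\<^sub>F s in U. X \<subseteq> univ (M' s)" if "X \<subseteq> univ M" "|X| \<le>o LS" for X
    unfolding subset_eq by (rule small_ball[OF that(2) cover]) (use that(1) in auto)
  have image_strong: "sub (induced \<tau> H (?g ` X)) H"
    if X: "|X| \<le>o LS" "sub (induced \<tau> M X) M" for X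
  proof -
    have XM: "X \<subseteq> univ M" using sub_univ[OF X(2)] by simp
    have "strong (?e ` X)"
      unfolding strong_def using cover_small[OF XM X(1)] sub_M emb
    proof eventually_elim
      case (elim s)
      have M's: "M' s = induced \<tau> M (univ (M' s))" using sub_induced[OF elim(2)] .
      \<comment> \<open>Coherence: \<open>X\<close> and \<open>M' s\<close> are both strong in
        \<open>M\<close>, so \<open>X\<close> is strong in \<open>M' s\<close>, the domain of
        \<open>e s\<close>.\<close>
      have "sub (induced \<tau> M X) (M' s)"
        using sub_induced_mono[OF X(2) _ elim(1)] elim(2) M's by simp
      moreover have "induced \<tau> M X = induced \<tau> (M' s) X"
        using induced_induced[OF elim(1), of \<tau> M] M's by simp
      ultimately have "sub (induced \<tau> (N s) (e s ` X)) (N s)"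
        using K_embedding_strong_image[OF elim(3)] by simp
      then show ?case by (simp add: image_image)
    qed
    then have "sub (induced \<tau> H (\<pi> ` ?e ` X)) H"
      using eQ XM ordLeq_transitive[OF card_of_image X(1)] by (intro strong_image_H) auto
    then show ?thesis by (simp add: image_image)
  qed
  obtain d where d: "\<And>A. A \<in> Fpow (univ M) \<Longrightarrow>
        A \<subseteq> d A \<and> d A \<subseteq> univ M \<and> |d A| \<le>o LS \<and> sub (induced \<tau> M (d A)) M"
    and d_mono: "\<And>A B. B \<in> Fpow (univ M) \<Longrightarrow> A \<subseteq> B \<Longrightarrow> d A \<subseteq> d B"
    using monotone_finite_choice[OF LS_Cinfinite, of "univ M" "\<lambda>X. sub (induced \<tau> M X) M"]
      small_strong_superset[OF M] by blast
  have "sub (induced \<tau> H (\<Union>A\<in>Fpow (univ M). ?g ` d A)) H"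
  proof (rule directed_union(3))
    show "|univ M| \<le>o |UNIV :: 'a set|" by (simp add: card_of_mono1)
  next
    fix A B assume "B \<in> Fpow (univ M)" "A \<subseteq> B"
    then show "sub (induced \<tau> H (?g ` d A)) (induced \<tau> H (?g ` d B))"
      using d d_mono[of B A] Fpow_mem_mono[of B "univ M" A]
      by (intro sub_induced_mono image_strong image_mono) auto
  qed (use d image_strong in blast)
  moreover have "(\<Union>A\<in>Fpow (univ M). d A) = univ M"
  proof
    show "univ M \<subseteq> (\<Union>A\<in>Fpow (univ M). d A)"
    proof
      fix x assume "x \<in> univ M"
      then have "{x} \<in> Fpow (univ M)" by (simp add: Fpow_def)
      then show "x \<in> (\<Union>A\<in>Fpow (univ M). d A)" using d[of "{x}"] by auto
    qed
  qed (use d in auto)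
  ultimately have gM: "sub (induced \<tau> H (?g ` univ M)) H" by (metis image_UN)
  have inj_e: "inj_on (e s) (univ (M' s))" if "K_embedding \<tau> sub (e s) (M' s) (N s)" for s
    using that by (auto simp: K_embedding_def isomorphism_def bij_betw_def)
  have Ms: "is_structure \<tau> M" using structures M .
  have tup_cover: "\<forall>\<^sub>F s in U. xs \<in> tuples (univ (M' s)) n" if "xs \<in> tuples (univ M) n" for xs n
    using cover_small[of "set xs"] that
      ordLess_imp_ordLeq[OF finite_ordLess_Cinfinite[OF _ LS_Cinfinite, of "set xs"]]
    by (auto simp: tuples_def elim: eventually_mono)
  have "isomorphism \<tau> ?g M (induced \<tau> H (?g ` univ M))"
    unfolding isomorphism_def
  proof (intro conjI ballI)
    show "is_structure \<tau> M" by (rule Ms)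
    show "is_structure \<tau> (induced \<tau> H (?g ` univ M))" using gM sub_models structures by blast
    have "inj_on ?g (univ M)"
    proof
      \<comment> \<open>One \<open>s\<close> with both points in \<open>M' s\<close> suffices,
        because \<open>x = y\<close> does not depend on \<open>s\<close>.\<close>
      fix x y assume xy: "x \<in> univ M" "y \<in> univ M" "?g x = ?g y"
      then have "\<forall>\<^sub>F s in U. e s x = e s y" using \<pi>_iff[OF eT eT] by simp
      then have "\<forall>\<^sub>F s in U. x = y"
        using cover[OF xy(1)] cover[OF xy(2)] emb
        by eventually_elim (auto dest: inj_e inj_onD)
      then show "x = y" using U(1) by (auto simp: ultrafilter_def)
    qed
    then show "bij_betw ?g (univ M) (univ (induced \<tau> H (?g ` univ M)))" by (simp add: bij_betw_def)
  next
    fix f xs assume f: "f \<in> Funs \<tau>" and xs: "xs \<in> tuples (univ M) (fun_arity \<tau> f)"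
    have ts: "map ?e xs \<in> tuples T (fun_arity \<tau> f)" using xs eT by (intro map_in_tuples) auto
    have y: "fun_int M f xs \<in> univ M" using Ms f xs by (auto simp: is_structure_def)
    have "\<forall>\<^sub>F s in U. e s (fun_int M f xs) = fun_int (N s) f (map (\<lambda>t. t s) (map ?e xs))"
      using tup_cover[OF xs] sub_M emb
    proof eventually_elim
      case (elim s)
      obtain N' where N': "sub N' (N s)" "isomorphism \<tau> (e s) (M' s) N'"
        using elim(3) by (auto simp: K_embedding_def)
      have "fun_int M f xs = fun_int (M' s) f xs"
        using sub_substructure[OF elim(2)] f elim(1) by (simp add: substructure_def)
      moreover have "e s (fun_int (M' s) f xs) = fun_int N' f (map (e s) xs)"
        using N'(2) f elim(1) by (simp add: isomorphism_def)
      moreover have "map (e s) xs \<in> tuples (univ N') (fun_arity \<tau> f)"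
        using elim(1) by (rule map_in_tuples) (use N'(2) in \<open>auto simp: isomorphism_def bij_betw_def\<close>)
      then have "fun_int N' f (map (e s) xs) = fun_int (N s) f (map (e s) xs)"
        using sub_substructure[OF N'(1)] f by (simp add: substructure_def)
      ultimately show ?case by (simp add: o_def)
    qed
    then have "fun_int H f (map \<pi> (map ?e xs)) = ?g (fun_int M f xs)"
      using fun_int_H[OF f ts eT[OF y]] by simp
    moreover have "map ?g xs \<in> tuples (?g ` univ M) (fun_arity \<tau> f)"
      using xs by (rule map_in_tuples) simp
    ultimately show "?g (fun_int M f xs) = fun_int (induced \<tau> H (?g ` univ M)) f (map ?g xs)"
      using f by (simp add: induced_def o_def)
  next
    fix R xs assume R: "R \<in> Rels \<tau>" and xs: "xs \<in> tuples (univ M) (rel_arity \<tau> R)"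
    have ts: "map ?e xs \<in> tuples T (rel_arity \<tau> R)" using xs eT by (intro map_in_tuples) auto
    have "\<forall>\<^sub>F s in U. map (\<lambda>t. t s) (map ?e xs) \<in> rel_int (N s) R \<longleftrightarrow> xs \<in> rel_int M R"
      using tup_cover[OF xs] sub_M emb
    proof eventually_elim
      case (elim s)
      obtain N' where N': "sub N' (N s)" "isomorphism \<tau> (e s) (M' s) N'"
        using elim(3) by (auto simp: K_embedding_def)
      have "xs \<in> rel_int M R \<longleftrightarrow> xs \<in> rel_int (M' s) R"
        using sub_substructure[OF elim(2)] R elim(1) by (simp add: substructure_def)
      moreover have "xs \<in> rel_int (M' s) R \<longleftrightarrow> map (e s) xs \<in> rel_int N' R"
        using N'(2) R elim(1) by (simp add: isomorphism_def)
      moreover have "map (e s) xs \<in> tuples (univ N') (rel_arity \<tau> R)"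
        using elim(1) by (rule map_in_tuples) (use N'(2) in \<open>auto simp: isomorphism_def bij_betw_def\<close>)
      then have "map (e s) xs \<in> rel_int N' R \<longleftrightarrow> map (e s) xs \<in> rel_int (N s) R"
        using sub_substructure[OF N'(1)] R by (simp add: substructure_def)
      ultimately show ?case by (simp add: o_def)
    qed
    then have "(\<forall>\<^sub>F s in U. map (\<lambda>t. t s) (map ?e xs) \<in> rel_int (N s) R) \<longleftrightarrow> (\<forall>\<^sub>F s in U. xs \<in> rel_int M R)"
      by (rule eventually_subst)
    then have "map \<pi> (map ?e xs) \<in> rel_int H R \<longleftrightarrow> xs \<in> rel_int M R"
      using rel_int_H[OF R ts] U(1) by (simp add: ultrafilter_def)
    moreover have "map ?g xs \<in> tuples (?g ` univ M) (rel_arity \<tau> R)"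
      using xs by (rule map_in_tuples) simp
    ultimately show "xs \<in> rel_int M R \<longleftrightarrow> map ?g xs \<in> rel_int (induced \<tau> H (?g ` univ M)) R"
      using R by (simp add: induced_def o_def)
  qed
  then show ?thesis using gM by (auto simp: K_embedding_def)
qed

end

section \<open>Transfer from small models\<close>

context abstract_elementary_class
begin

text \<open>By \<open>ext\<close>, a set of at most \<open>LS\<close> functions extends to one of
  the same size whose evaluations are strong almost everywhere. Monotone choice gives
  \<open>c\<close>, and the resulting hull has at most as many functions as \<open>'a\<close> has
  elements.\<close>

lemma ultraproduct_hull_exists:
  fixes \<kappa> :: "'k rel" and U :: "'i filter" and N :: "'i \<Rightarrow> ('a, 'f, 'r) fo_structure"
    and Q :: "('i \<Rightarrow> 'a) set"
  assumes U: "ultrafilter U" "complete_filter \<kappa> U" and LS_less: "LS <o \<kappa>"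
    and NK: "\<And>s. N s \<in> K"
    and LS_UNIV: "LS \<le>o |UNIV :: 'a set|"
    and Q: "|Q| \<le>o |UNIV :: 'a set|" "\<And>t. t \<in> Q \<Longrightarrow> \<forall>\<^sub>F s in U. t s \<in> univ (N s)"
  obtains c \<pi> where "ultraproduct_hull \<tau> K sub LS \<kappa> U N Q c \<pi>"
proof -
  define Z where "Z = {t. \<forall>\<^sub>F s in U. t s \<in> univ (N s)}"
  define good where "good C \<longleftrightarrow> (\<forall>\<^sub>F s in U. sub (induced \<tau> (N s) ((\<lambda>t. t s) ` C)) (N s))"
    for C :: "('i \<Rightarrow> 'a) set"
  have ext: "\<exists>C. B \<subseteq> C \<and> C \<subseteq> Z \<and> |C| \<le>o LS \<and> good C" if B: "B \<subseteq> Z" "|B| \<le>o LS" for B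
  proof -
    \<comment> \<open>The intersection with \<open>univ (N s)\<close> is needed because functions in
      \<open>B\<close> take values in \<open>N s\<close> only for almost every
      \<open>s\<close>.\<close>
    have "\<exists>X. (\<lambda>t. t s) ` B \<inter> univ (N s) \<subseteq> X \<and> X \<subseteq> univ (N s) \<and> |X| \<le>o LS \<and>
        sub (induced \<tau> (N s) X) (N s)" for s
    proof (rule small_strong_superset[OF NK])
      have "|(\<lambda>t. t s) ` B \<inter> univ (N s)| \<le>o |(\<lambda>t. t s) ` B|" by (rule card_of_mono1) auto
      also have "|(\<lambda>t. t s) ` B| \<le>o |B|" by (rule card_of_image)
      also note B(2)
      finally show "|(\<lambda>t. t s) ` B \<inter> univ (N s)| \<le>o LS" .
    qed simp
    then obtain X where X: "\<And>s. (\<lambda>t. t s) ` B \<inter> univ (N s) \<subseteq> X s" "\<And>s. X s \<subseteq> univ (N s)"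
      "\<And>s. |X s| \<le>o LS" "\<And>s. sub (induced \<tau> (N s) (X s)) (N s)" by metis
    \<comment> \<open>Every \<open>X s\<close> is enumerated by the same index set
      \<open>Field LS\<close>. Reading one index at all \<open>s\<close> gives a function, and these
      \<open>LS\<close> many functions evaluate exactly to \<open>X s\<close>.\<close>
    have "\<exists>g. g ` Field LS = X s" for s
    proof -
      have "X s \<noteq> {}" using sub_closed_in[OF X(4)[of s]] by (simp add: closed_in_def)
      moreover have "|X s| \<le>o |Field LS|"
        using X(3)[of s] LS_Cinfinite card_of_Field_ordIso ordIso_symmetric ordLeq_ordIso_trans by blast
      ultimately show ?thesis using card_of_ordLeq2[of "X s" "Field LS"] by simp
    qed
    then obtain g where g: "\<And>s. g s ` Field LS = X s" by metis
    let ?C = "B \<union> (\<lambda>i s. g s i) ` Field LS"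
    have "|(\<lambda>i s. g s i) ` Field LS| \<le>o LS"
      by (rule ordLeq_ordIso_trans[OF card_of_image card_of_Field_ordIso]) (use LS_Cinfinite in simp)
    then have "|?C| \<le>o LS" using B(2) LS_Cinfinite by (intro Un_Cinfinite_bound)
    moreover have "g s i \<in> univ (N s)" if "i \<in> Field LS" for s i
      using g[of s] X(2)[of s] that by blast
    then have "?C \<subseteq> Z" using B(1) by (auto simp: Z_def)
    moreover have "\<forall>\<^sub>F s in U. \<forall>t\<in>B. t s \<in> univ (N s)"
      using B(1) by (intro complete_filter_eventually_ball[OF U(2) ordLeq_ordLess_trans[OF B(2) LS_less]])
        (auto simp: Z_def)
    then have "good ?C"
      unfolding good_def
    proof eventually_elim
      case (elim s)
      have "(\<lambda>t. t s) ` ?C = X s" using X(1)[of s] g[of s] elim by (auto simp: image_Un image_image)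
      then show ?case using X(4)[of s] by simp
    qed
    ultimately show ?thesis by blast
  qed
  obtain c where c: "\<And>A. A \<in> Fpow Z \<Longrightarrow> A \<subseteq> c A \<and> c A \<subseteq> Z \<and> |c A| \<le>o LS \<and> good (c A)"
    and c_mono: "\<And>A B. B \<in> Fpow Z \<Longrightarrow> A \<subseteq> B \<Longrightarrow> c A \<subseteq> c B"
    using monotone_finite_choice[OF LS_Cinfinite, of Z good] ext by blast
  have QZ: "Fpow Q \<subseteq> Fpow Z" using Q(2) by (intro Fpow_mono) (auto simp: Z_def)
  define T where "T = (\<Union>A\<in>Fpow Q. c A)"
  have inf: "Cinfinite |UNIV :: 'a set|"
    using LS_Cinfinite cinfinite_mono[OF LS_UNIV] card_of_card_order_on by (auto simp: Field_card_of)
  have "|T| \<le>o |UNIV :: 'a set|"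
    unfolding T_def
  proof (rule UNION_Cinfinite_bound[OF card_of_Fpow[OF Q(1) inf] _ inf])
    show "\<forall>A\<in>Fpow Q. |c A| \<le>o |UNIV :: 'a set|"
      using c QZ ordLeq_transitive[OF _ LS_UNIV] by blast
  qed
  then obtain g :: "('i \<Rightarrow> 'a) \<Rightarrow> 'a" where g: "inj_on g T" by (metis card_of_ordLeq)
  \<comment> \<open>Functions equal almost everywhere satisfy the same choice predicate and so
    receive the same representative; the injection \<open>g\<close> then places the classes into
    \<open>'a\<close>.\<close>
  define rep where "rep t = (SOME u. u \<in> T \<and> (\<forall>\<^sub>F s in U. u s = t s))" for t
  have rep: "rep t \<in> T \<and> (\<forall>\<^sub>F s in U. rep t s = t s)" if "t \<in> T" for t
    unfolding rep_def by (rule someI[of _ t]) (use that in simp)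
  have rep_eq: "rep t = rep u \<longleftrightarrow> (\<forall>\<^sub>F s in U. t s = u s)" if "t \<in> T" "u \<in> T" for t u
  proof
    assume "rep t = rep u"
    then have "\<forall>\<^sub>F s in U. rep t s = t s" "\<forall>\<^sub>F s in U. rep t s = u s" using rep that by metis+
    then show "\<forall>\<^sub>F s in U. t s = u s" by eventually_elim simp
  next
    assume tu: "\<forall>\<^sub>F s in U. t s = u s"
    have "(\<forall>\<^sub>F s in U. v s = t s) \<longleftrightarrow> (\<forall>\<^sub>F s in U. v s = u s)" for v
      using tu by (intro eventually_subst) (auto elim: eventually_mono)
    then show "rep t = rep u" by (simp add: rep_def)
  qed
  have "ultraproduct_hull \<tau> K sub LS \<kappa> U N Q c (\<lambda>t. g (rep t))"
  proof unfold_locales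
    fix t u assume "t \<in> (\<Union>A\<in>Fpow Q. c A)" "u \<in> (\<Union>A\<in>Fpow Q. c A)"
    then have tu: "t \<in> T" "u \<in> T" by (auto simp: T_def)
    show "g (rep t) = g (rep u) \<longleftrightarrow> (\<forall>\<^sub>F s in U. t s = u s)"
      using rep_eq[OF tu] inj_on_eq_iff[OF g, of "rep t" "rep u"] rep[OF tu(1)] rep[OF tu(2)] by simp
  next
    fix A assume "A \<in> Fpow Q"
    then have A: "A \<in> Fpow Z" using QZ by blast
    show "A \<subseteq> c A" "|c A| \<le>o LS" "\<forall>\<^sub>F s in U. sub (induced \<tau> (N s) ((\<lambda>t. t s) ` c A)) (N s)"
      using c[OF A] by (simp_all add: good_def)
  next
    fix A B assume "B \<in> Fpow Q" "A \<subseteq> B"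
    then show "c A \<subseteq> c B" using QZ by (intro c_mono) auto
  qed (fact U LS_less Q(1))+
  then show thesis by (rule that)
qed

lemma ultraproduct_joint_embedding:
  fixes \<kappa> :: "'k rel" and U :: "'i filter"
  assumes U: "ultrafilter U" "complete_filter \<kappa> U" and LS_less: "LS <o \<kappa>"
    and LS_UNIV: "LS \<le>o |UNIV :: 'a set|"
    and M: "M\<^sub>1 \<in> K" "M\<^sub>2 \<in> K"
    and N: "\<forall>\<^sub>F s in U. N s \<in> K"
    and sub_M: "\<forall>\<^sub>F s in U. sub (M\<^sub>1' s) M\<^sub>1" "\<forall>\<^sub>F s in U. sub (M\<^sub>2' s) M\<^sub>2"
    and emb: "\<forall>\<^sub>F s in U. K_embedding \<tau> sub (f\<^sub>1 s) (M\<^sub>1' s) (N s)"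
      "\<forall>\<^sub>F s in U. K_embedding \<tau> sub (f\<^sub>2 s) (M\<^sub>2' s) (N s)"
    and cover: "\<And>x. x \<in> univ M\<^sub>1 \<Longrightarrow> \<forall>\<^sub>F s in U. x \<in> univ (M\<^sub>1' s)"
      "\<And>x. x \<in> univ M\<^sub>2 \<Longrightarrow> \<forall>\<^sub>F s in U. x \<in> univ (M\<^sub>2' s)"
  obtains H g\<^sub>1 g\<^sub>2 where "H \<in> K" "K_embedding \<tau> sub g\<^sub>1 M\<^sub>1 H" "K_embedding \<tau> sub g\<^sub>2 M\<^sub>2 H"
    "\<forall>x\<in>univ M\<^sub>1. \<forall>y\<in>univ M\<^sub>2. g\<^sub>1 x = g\<^sub>2 y \<longleftrightarrow> (\<forall>\<^sub>F s in U. f\<^sub>1 s x = f\<^sub>2 s y)"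
proof -
  \<comment> \<open>The hull needs a model at every index, not just at almost every one;
    \<open>M\<^sub>1\<close> is the default value on the null set.\<close>
  define N' where "N' s = (if N s \<in> K then N s else M\<^sub>1)" for s
  have N': "\<forall>\<^sub>F s in U. N' s = N s" using N by (rule eventually_mono) (simp add: N'_def)
  have emb': "\<forall>\<^sub>F s in U. K_embedding \<tau> sub (f\<^sub>1 s) (M\<^sub>1' s) (N' s)"
     "\<forall>\<^sub>F s in U. K_embedding \<tau> sub (f\<^sub>2 s) (M\<^sub>2' s) (N' s)"
    using emb N' by (eventually_elim, simp)+
  have img: "f x \<in> univ P" if "K_embedding \<tau> sub f M P" "x \<in> univ M" for f M P x
    using that by (auto simp: K_embedding_def isomorphism_def bij_betw_def dest!: sub_univ)
  \<comment> \<open>The generators are the images of the points of both models in the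
    ultraproduct.\<close>
  define Q where "Q = (\<lambda>x s. f\<^sub>1 s x) ` univ M\<^sub>1 \<union> (\<lambda>x s. f\<^sub>2 s x) ` univ M\<^sub>2"
  have inf: "Cinfinite |UNIV :: 'a set|"
    using LS_Cinfinite cinfinite_mono[OF LS_UNIV] card_of_card_order_on by (auto simp: Field_card_of)
  have small: "|h ` X| \<le>o |UNIV :: 'a set|" for h :: "'a \<Rightarrow> 'i \<Rightarrow> 'a" and X
    using card_of_image card_of_mono1[OF subset_UNIV] by (rule ordLeq_transitive)
  have Q: "|Q| \<le>o |UNIV :: 'a set|"
    unfolding Q_def using small small inf by (rule Un_Cinfinite_bound)
  have QN: "\<forall>\<^sub>F s in U. t s \<in> univ (N' s)" if "t \<in> Q" for t
    using that unfolding Q_def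
  proof (elim UnE imageE)
    fix x assume x: "t = (\<lambda>s. f\<^sub>1 s x)" "x \<in> univ M\<^sub>1"
    from cover(1)[OF x(2)] emb'(1) show ?thesis by eventually_elim (use x img in auto)
  next
    fix x assume x: "t = (\<lambda>s. f\<^sub>2 s x)" "x \<in> univ M\<^sub>2"
    from cover(2)[OF x(2)] emb'(2) show ?thesis by eventually_elim (use x img in auto)
  qed
  have NK': "N' s \<in> K" for s using M by (simp add: N'_def)
  obtain c \<pi> where "ultraproduct_hull \<tau> K sub LS \<kappa> U N' Q c \<pi>"
    using ultraproduct_hull_exists[where N = N', OF U LS_less NK' LS_UNIV Q QN] .
  then interpret uh: ultraproduct_hull \<tau> K sub LS \<kappa> U N' Q c \<pi> .
  show thesis
  proof (rule that)
    show "uh.H \<in> K" by (rule uh.H_in_K)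
    show "K_embedding \<tau> sub (\<lambda>x. \<pi> (\<lambda>s. f\<^sub>1 s x)) M\<^sub>1 uh.H"
      by (rule uh.K_embedding_H[OF M(1) sub_M(1) emb'(1) cover(1)]) (auto simp: Q_def)
    show "K_embedding \<tau> sub (\<lambda>x. \<pi> (\<lambda>s. f\<^sub>2 s x)) M\<^sub>2 uh.H"
      by (rule uh.K_embedding_H[OF M(2) sub_M(2) emb'(2) cover(2)]) (auto simp: Q_def)
    show "\<forall>x\<in>univ M\<^sub>1. \<forall>y\<in>univ M\<^sub>2. \<pi> (\<lambda>s. f\<^sub>1 s x) = \<pi> (\<lambda>s. f\<^sub>2 s y) \<longleftrightarrow>
        (\<forall>\<^sub>F s in U. f\<^sub>1 s x = f\<^sub>2 s y)"
    proof (intro ballI)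
      fix x y assume "x \<in> univ M\<^sub>1" "y \<in> univ M\<^sub>2"
      then have "(\<lambda>s. f\<^sub>1 s x) \<in> Q" "(\<lambda>s. f\<^sub>2 s y) \<in> Q" by (auto simp: Q_def)
      then show "\<pi> (\<lambda>s. f\<^sub>1 s x) = \<pi> (\<lambda>s. f\<^sub>2 s y) \<longleftrightarrow> (\<forall>\<^sub>F s in U. f\<^sub>1 s x = f\<^sub>2 s y)"
        using uh.Q_subset_T by (intro uh.\<pi>_iff) auto
    qed
  qed
qed

section \<open>Approximation by small submodels\<close>

lemma small_submodel:
  fixes \<kappa> :: "'k rel"
  assumes \<kappa>: "Card_order \<kappa>" "LS <o \<kappa>" and LS_le: "\<forall>M\<in>K. LS \<le>o |univ M|"
    and M: "M \<in> K" "A \<subseteq> univ M" "|A| <o \<kappa>"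
  shows "\<exists>M'\<in>models_below K LS \<kappa>. A \<subseteq> univ M' \<and> sub M' M"
proof -
  obtain M' where M': "M' \<in> K" "A \<subseteq> univ M'" "sub M' M" "|univ M'| \<le>o |A| +c LS"
    using LS_bound M unfolding LS_bound_def by blast
  have \<kappa>': "Cinfinite \<kappa>" using \<kappa> LS_Cinfinite cinfinite_mono ordLess_imp_ordLeq by blast
  have "|Field LS| =o LS" using LS_Cinfinite card_of_Field_ordIso by blast
  then have "|Field LS| <o \<kappa>" using \<kappa>(2) by (rule ordIso_ordLess_trans)
  then have "|A <+> Field LS| <o \<kappa>"
    using card_of_Plus_ordLess_infinite_Field[of \<kappa> A "Field LS"] \<kappa>' M(3) by (auto simp: cinfinite_def)
  then have "|A| +c LS <o \<kappa>" by (simp add: csum_def Field_card_of)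
  then have "|univ M'| <o \<kappa>" using M'(4) ordLeq_ordLess_trans by blast
  \<comment> \<open>The lower bound on the size that \<open>models_below\<close> demands comes from
    \<open>LS_le\<close>.\<close>
  then show ?thesis using M' LS_le by (auto simp: models_below_def)
qed

text \<open>The flag \<open>disjoint\<close> lets one proof serve both AP and DAP.\<close>

lemma amalgamation_of_small:
  fixes \<kappa> :: "'k rel"
  assumes sc: "strongly_compact TYPE('a set) \<kappa>" and LS_less: "LS <o \<kappa>"
    and LS_le: "\<forall>M\<in>K. LS \<le>o |univ M|"
    and small: "\<And>M\<^sub>0 M\<^sub>1 M\<^sub>2. M\<^sub>0 \<in> models_below K LS \<kappa> \<Longrightarrow> M\<^sub>1 \<in> models_below K LS \<kappa> \<Longrightarrow>
      M\<^sub>2 \<in> models_below K LS \<kappa> \<Longrightarrow> sub M\<^sub>0 M\<^sub>1 \<Longrightarrow> sub M\<^sub>0 M\<^sub>2 \<Longrightarrow>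
      \<exists>N\<in>K. \<exists>f\<^sub>1 f\<^sub>2. K_embedding \<tau> sub f\<^sub>1 M\<^sub>1 N \<and> K_embedding \<tau> sub f\<^sub>2 M\<^sub>2 N \<and>
         (\<forall>x\<in>univ M\<^sub>0. f\<^sub>1 x = f\<^sub>2 x) \<and>
         (disjoint \<longrightarrow> f\<^sub>1 ` univ M\<^sub>1 \<inter> f\<^sub>2 ` univ M\<^sub>2 = f\<^sub>1 ` univ M\<^sub>0)"
    and M: "sub M\<^sub>0 M\<^sub>1" "sub M\<^sub>0 M\<^sub>2"
  shows "\<exists>N\<in>K. \<exists>f\<^sub>1 f\<^sub>2. K_embedding \<tau> sub f\<^sub>1 M\<^sub>1 N \<and> K_embedding \<tau> sub f\<^sub>2 M\<^sub>2 N \<and>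
         (\<forall>x\<in>univ M\<^sub>0. f\<^sub>1 x = f\<^sub>2 x) \<and>
         (disjoint \<longrightarrow> f\<^sub>1 ` univ M\<^sub>1 \<inter> f\<^sub>2 ` univ M\<^sub>2 = f\<^sub>1 ` univ M\<^sub>0)"
proof -
  have \<kappa>: "Card_order \<kappa>" using sc by (simp add: strongly_compact_def)
  have \<kappa>': "Cinfinite \<kappa>" using \<kappa> LS_Cinfinite cinfinite_mono LS_less ordLess_imp_ordLeq by blast
  obtain U :: "'a set filter" where U: "ultrafilter U" "complete_filter \<kappa> U"
    and U_small: "\<forall>\<^sub>F s in U. |s| <o \<kappa>" and U_fine: "\<forall>x. \<forall>\<^sub>F s in U. x \<in> s"
    using strongly_compact_fine_ultrafilter[OF sc \<kappa>'] .
  have MK: "M\<^sub>0 \<in> K" "M\<^sub>1 \<in> K" "M\<^sub>2 \<in> K" using M sub_models by blast+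
  have LS_UNIV: "LS \<le>o |UNIV :: 'a set|"
    using LS_le MK(1) card_of_mono1[OF subset_UNIV] ordLeq_transitive by blast
  \<comment> \<open>Inclusion of the base in \<open>A\<^sub>1\<close> is recorded because the
    disjointness argument pulls points of the base back along \<open>f\<^sub>1\<close>, which is
    injective only on \<open>A\<^sub>1\<close>.\<close>
  define approx where "approx s A\<^sub>0 A\<^sub>1 A\<^sub>2 N f\<^sub>1 f\<^sub>2 \<longleftrightarrow>
      sub A\<^sub>0 M\<^sub>0 \<and> sub A\<^sub>1 M\<^sub>1 \<and> sub A\<^sub>2 M\<^sub>2 \<and>
      s \<inter> univ M\<^sub>0 \<subseteq> univ A\<^sub>0 \<and> s \<inter> univ M\<^sub>1 \<subseteq> univ A\<^sub>1 \<and> s \<inter> univ M\<^sub>2 \<subseteq> univ A\<^sub>2 \<and>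
      univ A\<^sub>0 \<subseteq> univ A\<^sub>1 \<and>
      N \<in> K \<and> K_embedding \<tau> sub f\<^sub>1 A\<^sub>1 N \<and> K_embedding \<tau> sub f\<^sub>2 A\<^sub>2 N \<and>
      (\<forall>x\<in>univ A\<^sub>0. f\<^sub>1 x = f\<^sub>2 x) \<and> (disjoint \<longrightarrow> f\<^sub>1 ` univ A\<^sub>1 \<inter> f\<^sub>2 ` univ A\<^sub>2 = f\<^sub>1 ` univ A\<^sub>0)"
    for s A\<^sub>0 A\<^sub>1 A\<^sub>2 N f\<^sub>1 f\<^sub>2
  have "\<exists>A\<^sub>0 A\<^sub>1 A\<^sub>2 N f\<^sub>1 f\<^sub>2. approx s A\<^sub>0 A\<^sub>1 A\<^sub>2 N f\<^sub>1 f\<^sub>2" if s: "|s| <o \<kappa>" for s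
  proof -
    have s\<kappa>: "|s \<inter> X| <o \<kappa>" for X
      using card_of_mono1[of "s \<inter> X" s] s ordLeq_ordLess_trans by blast
    obtain A\<^sub>0 where A\<^sub>0: "A\<^sub>0 \<in> models_below K LS \<kappa>" "s \<inter> univ M\<^sub>0 \<subseteq> univ A\<^sub>0" "sub A\<^sub>0 M\<^sub>0"
      using small_submodel[OF \<kappa> LS_less LS_le MK(1) _ s\<kappa>[of "univ M\<^sub>0"]] by auto
    \<comment> \<open>The base \<open>A\<^sub>0\<close> is chosen first and its universe is added to
      the set to be covered, so that coherence makes it strong in both extensions.\<close>
    have ext: "\<exists>A\<in>models_below K LS \<kappa>. s \<inter> univ P \<subseteq> univ A \<and> sub A P \<and> sub A\<^sub>0 A" if P: "sub M\<^sub>0 P" for P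
    proof -
      have A\<^sub>0P: "sub A\<^sub>0 P" using A\<^sub>0(3) P by (rule sub_trans)
      have "|univ A\<^sub>0 \<union> (s \<inter> univ P)| <o \<kappa>"
        using A\<^sub>0(1) s\<kappa> \<kappa>' by (intro Un_Cinfinite_bound_strict) (auto simp: models_below_def)
      then obtain A where A: "A \<in> models_below K LS \<kappa>" "univ A\<^sub>0 \<union> (s \<inter> univ P) \<subseteq> univ A" "sub A P"
        using small_submodel[OF \<kappa> LS_less LS_le, of P "univ A\<^sub>0 \<union> (s \<inter> univ P)"]
          sub_univ[OF A\<^sub>0P] sub_models[OF P] by auto
      have "sub A\<^sub>0 A"
        using sub_induced_mono[of P "univ A\<^sub>0" "univ A"] A A\<^sub>0P sub_induced[OF A(3)] sub_induced[OF A\<^sub>0P]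
        by simp
      then show ?thesis using A by blast
    qed
    obtain A\<^sub>1 where A\<^sub>1: "A\<^sub>1 \<in> models_below K LS \<kappa>" "s \<inter> univ M\<^sub>1 \<subseteq> univ A\<^sub>1" "sub A\<^sub>1 M\<^sub>1" "sub A\<^sub>0 A\<^sub>1"
      using ext[OF M(1)] by blast
    obtain A\<^sub>2 where A\<^sub>2: "A\<^sub>2 \<in> models_below K LS \<kappa>" "s \<inter> univ M\<^sub>2 \<subseteq> univ A\<^sub>2" "sub A\<^sub>2 M\<^sub>2" "sub A\<^sub>0 A\<^sub>2"
      using ext[OF M(2)] by blast
    show ?thesis
      using small[OF A\<^sub>0(1) A\<^sub>1(1) A\<^sub>2(1) A\<^sub>1(4) A\<^sub>2(4)] A\<^sub>0 A\<^sub>1 A\<^sub>2 sub_univ[OF A\<^sub>1(4)]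
      unfolding approx_def by metis
  qed
  then obtain A\<^sub>0 A\<^sub>1 A\<^sub>2 N f\<^sub>1 f\<^sub>2
    where "\<And>s. |s| <o \<kappa> \<Longrightarrow> approx s (A\<^sub>0 s) (A\<^sub>1 s) (A\<^sub>2 s) (N s) (f\<^sub>1 s) (f\<^sub>2 s)"
    by metis
  with U_small have ap: "\<forall>\<^sub>F s in U. approx s (A\<^sub>0 s) (A\<^sub>1 s) (A\<^sub>2 s) (N s) (f\<^sub>1 s) (f\<^sub>2 s)"
    by (auto elim: eventually_mono)
  have cover: "\<forall>\<^sub>F s in U. x \<in> univ (A\<^sub>0 s)" if "x \<in> univ M\<^sub>0" for x
    using ap U_fine[rule_format, of x] by eventually_elim (use that in \<open>auto simp: approx_def\<close>)
  have cover1: "\<forall>\<^sub>F s in U. x \<in> univ (A\<^sub>1 s)" if "x \<in> univ M\<^sub>1" for x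
    using ap U_fine[rule_format, of x] by eventually_elim (use that in \<open>auto simp: approx_def\<close>)
  have cover2: "\<forall>\<^sub>F s in U. x \<in> univ (A\<^sub>2 s)" if "x \<in> univ M\<^sub>2" for x
    using ap U_fine[rule_format, of x] by eventually_elim (use that in \<open>auto simp: approx_def\<close>)
  obtain H g\<^sub>1 g\<^sub>2 where H: "H \<in> K" "K_embedding \<tau> sub g\<^sub>1 M\<^sub>1 H" "K_embedding \<tau> sub g\<^sub>2 M\<^sub>2 H"
    and g: "\<forall>x\<in>univ M\<^sub>1. \<forall>y\<in>univ M\<^sub>2. g\<^sub>1 x = g\<^sub>2 y \<longleftrightarrow> (\<forall>\<^sub>F s in U. f\<^sub>1 s x = f\<^sub>2 s y)"
  proof (rule ultraproduct_joint_embedding[OF U LS_less LS_UNIV MK(2,3) _ _ _ _ _ cover1 cover2])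
    show "\<forall>\<^sub>F s in U. N s \<in> K" "\<forall>\<^sub>F s in U. sub (A\<^sub>1 s) M\<^sub>1" "\<forall>\<^sub>F s in U. sub (A\<^sub>2 s) M\<^sub>2"
      "\<forall>\<^sub>F s in U. K_embedding \<tau> sub (f\<^sub>1 s) (A\<^sub>1 s) (N s)"
      "\<forall>\<^sub>F s in U. K_embedding \<tau> sub (f\<^sub>2 s) (A\<^sub>2 s) (N s)"
      using ap by (auto simp: approx_def elim: eventually_mono)
  qed
  have M0: "x \<in> univ M\<^sub>1" "x \<in> univ M\<^sub>2" if "x \<in> univ M\<^sub>0" for x
    using that M sub_univ by blast+
  have agree: "g\<^sub>1 x = g\<^sub>2 x" if "x \<in> univ M\<^sub>0" for x
  proof -
    have "\<forall>\<^sub>F s in U. f\<^sub>1 s x = f\<^sub>2 s x"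
      using ap cover[OF that] by eventually_elim (auto simp: approx_def)
    then show ?thesis using g M0[OF that] by blast
  qed
  moreover have "g\<^sub>1 ` univ M\<^sub>1 \<inter> g\<^sub>2 ` univ M\<^sub>2 = g\<^sub>1 ` univ M\<^sub>0" if disjoint
  proof
    show "g\<^sub>1 ` univ M\<^sub>0 \<subseteq> g\<^sub>1 ` univ M\<^sub>1 \<inter> g\<^sub>2 ` univ M\<^sub>2"
    proof
      fix z assume "z \<in> g\<^sub>1 ` univ M\<^sub>0"
      then obtain x where "x \<in> univ M\<^sub>0" "z = g\<^sub>1 x" by blast
      then show "z \<in> g\<^sub>1 ` univ M\<^sub>1 \<inter> g\<^sub>2 ` univ M\<^sub>2" using M0[of x] agree[of x] by blast
    qed
    show "g\<^sub>1 ` univ M\<^sub>1 \<inter> g\<^sub>2 ` univ M\<^sub>2 \<subseteq> g\<^sub>1 ` univ M\<^sub>0"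
    proof
      fix z assume "z \<in> g\<^sub>1 ` univ M\<^sub>1 \<inter> g\<^sub>2 ` univ M\<^sub>2"
      then obtain x y where xy: "z = g\<^sub>1 x" "x \<in> univ M\<^sub>1" "y \<in> univ M\<^sub>2" "g\<^sub>1 x = g\<^sub>2 y" by auto
      then have "\<forall>\<^sub>F s in U. f\<^sub>1 s x = f\<^sub>2 s y" using g by blast
      \<comment> \<open>At almost every \<open>s\<close> the common value lies in the image of
        \<open>A\<^sub>0\<close>, and injectivity of \<open>f\<^sub>1 s\<close> on
        \<open>A\<^sub>1 s\<close> puts \<open>x\<close> into \<open>A\<^sub>0 s\<close>. The
        conclusion no longer mentions \<open>s\<close>, so it holds outright.\<close>
      with ap cover1[OF xy(2)] cover2[OF xy(3)] have "\<forall>\<^sub>F s in U. x \<in> univ M\<^sub>0"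
      proof eventually_elim
        case (elim s)
        have "inj_on (f\<^sub>1 s) (univ (A\<^sub>1 s))"
          using elim(1) by (auto simp: approx_def K_embedding_def isomorphism_def bij_betw_def)
        moreover have A\<^sub>0: "univ (A\<^sub>0 s) \<subseteq> univ (A\<^sub>1 s)" "univ (A\<^sub>0 s) \<subseteq> univ M\<^sub>0"
          using elim(1) sub_univ[of "A\<^sub>0 s" M\<^sub>0] by (auto simp: approx_def)
        moreover have "f\<^sub>1 s ` univ (A\<^sub>1 s) \<inter> f\<^sub>2 s ` univ (A\<^sub>2 s) = f\<^sub>1 s ` univ (A\<^sub>0 s)"
          using elim(1) that by (simp add: approx_def)
        then have "f\<^sub>1 s x \<in> f\<^sub>1 s ` univ (A\<^sub>0 s)" using elim(2-4) by blast
        ultimately have "x \<in> univ (A\<^sub>0 s)" using elim(2) by (metis inj_on_image_mem_iff)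
        then show ?case using A\<^sub>0(2) by blast
      qed
      then have "x \<in> univ M\<^sub>0" using U(1) by (simp add: ultrafilter_def)
      then show "z \<in> g\<^sub>1 ` univ M\<^sub>0" using xy(1) by blast
    qed
  qed
  ultimately show ?thesis using H by blast
qed

lemma joint_embedding_of_small:
  fixes \<kappa> :: "'k rel"
  assumes sc: "strongly_compact TYPE('a set) \<kappa>" and LS_less: "LS <o \<kappa>"
    and LS_le: "\<forall>M\<in>K. LS \<le>o |univ M|"
    and small: "joint_embedding \<tau> K sub (models_below K LS \<kappa>)"
    and M: "M\<^sub>1 \<in> K" "M\<^sub>2 \<in> K"
  shows "\<exists>N\<in>K. \<exists>f\<^sub>1 f\<^sub>2. K_embedding \<tau> sub f\<^sub>1 M\<^sub>1 N \<and> K_embedding \<tau> sub f\<^sub>2 M\<^sub>2 N"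
proof -
  have \<kappa>: "Card_order \<kappa>" using sc by (simp add: strongly_compact_def)
  have \<kappa>': "Cinfinite \<kappa>" using \<kappa> LS_Cinfinite cinfinite_mono LS_less ordLess_imp_ordLeq by blast
  obtain U :: "'a set filter" where U: "ultrafilter U" "complete_filter \<kappa> U"
    and U_small: "\<forall>\<^sub>F s in U. |s| <o \<kappa>" and U_fine: "\<forall>x. \<forall>\<^sub>F s in U. x \<in> s"
    using strongly_compact_fine_ultrafilter[OF sc \<kappa>'] .
  have LS_UNIV: "LS \<le>o |UNIV :: 'a set|"
    using LS_le M(1) card_of_mono1[OF subset_UNIV] ordLeq_transitive by blast
  define approx where "approx s A\<^sub>1 A\<^sub>2 N f\<^sub>1 f\<^sub>2 \<longleftrightarrow>
      sub A\<^sub>1 M\<^sub>1 \<and> sub A\<^sub>2 M\<^sub>2 \<and> s \<inter> univ M\<^sub>1 \<subseteq> univ A\<^sub>1 \<and> s \<inter> univ M\<^sub>2 \<subseteq> univ A\<^sub>2 \<and>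
      N \<in> K \<and> K_embedding \<tau> sub f\<^sub>1 A\<^sub>1 N \<and> K_embedding \<tau> sub f\<^sub>2 A\<^sub>2 N"
    for s A\<^sub>1 A\<^sub>2 N f\<^sub>1 f\<^sub>2
  have "\<exists>A\<^sub>1 A\<^sub>2 N f\<^sub>1 f\<^sub>2. approx s A\<^sub>1 A\<^sub>2 N f\<^sub>1 f\<^sub>2" if s: "|s| <o \<kappa>" for s
  proof -
    have s\<kappa>: "|s \<inter> X| <o \<kappa>" for X
      using card_of_mono1[of "s \<inter> X" s] s ordLeq_ordLess_trans by blast
    obtain A\<^sub>1 where A\<^sub>1: "A\<^sub>1 \<in> models_below K LS \<kappa>" "s \<inter> univ M\<^sub>1 \<subseteq> univ A\<^sub>1" "sub A\<^sub>1 M\<^sub>1"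
      using small_submodel[OF \<kappa> LS_less LS_le M(1) _ s\<kappa>[of "univ M\<^sub>1"]] by auto
    obtain A\<^sub>2 where A\<^sub>2: "A\<^sub>2 \<in> models_below K LS \<kappa>" "s \<inter> univ M\<^sub>2 \<subseteq> univ A\<^sub>2" "sub A\<^sub>2 M\<^sub>2"
      using small_submodel[OF \<kappa> LS_less LS_le M(2) _ s\<kappa>[of "univ M\<^sub>2"]] by auto
    obtain N f\<^sub>1 f\<^sub>2 where "N \<in> K" "K_embedding \<tau> sub f\<^sub>1 A\<^sub>1 N" "K_embedding \<tau> sub f\<^sub>2 A\<^sub>2 N"
      using small A\<^sub>1(1) A\<^sub>2(1) unfolding joint_embedding_def by blast
    then show ?thesis using A\<^sub>1 A\<^sub>2 unfolding approx_def by blast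
  qed
  then obtain A\<^sub>1 A\<^sub>2 N f\<^sub>1 f\<^sub>2
    where "\<And>s. |s| <o \<kappa> \<Longrightarrow> approx s (A\<^sub>1 s) (A\<^sub>2 s) (N s) (f\<^sub>1 s) (f\<^sub>2 s)"
    by metis
  with U_small have ap: "\<forall>\<^sub>F s in U. approx s (A\<^sub>1 s) (A\<^sub>2 s) (N s) (f\<^sub>1 s) (f\<^sub>2 s)"
    by (auto elim: eventually_mono)
  have cover1: "\<forall>\<^sub>F s in U. x \<in> univ (A\<^sub>1 s)" if "x \<in> univ M\<^sub>1" for x
    using ap U_fine[rule_format, of x] by eventually_elim (use that in \<open>auto simp: approx_def\<close>)
  have cover2: "\<forall>\<^sub>F s in U. x \<in> univ (A\<^sub>2 s)" if "x \<in> univ M\<^sub>2" for x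
    using ap U_fine[rule_format, of x] by eventually_elim (use that in \<open>auto simp: approx_def\<close>)
  obtain H g\<^sub>1 g\<^sub>2 where "H \<in> K" "K_embedding \<tau> sub g\<^sub>1 M\<^sub>1 H" "K_embedding \<tau> sub g\<^sub>2 M\<^sub>2 H"
  proof (rule ultraproduct_joint_embedding[OF U LS_less LS_UNIV M _ _ _ _ _ cover1 cover2])
    show "\<forall>\<^sub>F s in U. N s \<in> K" "\<forall>\<^sub>F s in U. sub (A\<^sub>1 s) M\<^sub>1" "\<forall>\<^sub>F s in U. sub (A\<^sub>2 s) M\<^sub>2"
      "\<forall>\<^sub>F s in U. K_embedding \<tau> sub (f\<^sub>1 s) (A\<^sub>1 s) (N s)"
      "\<forall>\<^sub>F s in U. K_embedding \<tau> sub (f\<^sub>2 s) (A\<^sub>2 s) (N s)"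
      using ap by (auto simp: approx_def elim: eventually_mono)
  qed
  then show ?thesis by blast
qed

end

theorem theorem2p3:
  fixes \<kappa> :: "'k rel"
    and LS :: "'l rel"
    and \<tau> :: "('f, 'r) vocabulary"
    and K :: "('a, 'f, 'r) fo_structure set"
    and sub :: "('a, 'f, 'r) fo_structure \<Rightarrow> ('a, 'f, 'r) fo_structure \<Rightarrow> bool"
  assumes "strongly_compact TYPE('a set) \<kappa>"
    and "abstract_elementary_class \<tau> K sub LS"
    and "LS <o \<kappa>"
    and "\<forall>M\<in>K. LS \<le>o |univ M|"
  shows "(amalgamation \<tau> K sub (models_below K LS \<kappa>) \<longrightarrow> amalgamation \<tau> K sub K) \<and>
         (joint_embedding \<tau> K sub (models_below K LS \<kappa>) \<longrightarrow> joint_embedding \<tau> K sub K) \<and>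
         (disjoint_amalgamation \<tau> K sub (models_below K LS \<kappa>) \<longrightarrow>
            disjoint_amalgamation \<tau> K sub K)"
proof (intro conjI impI)
  interpret abstract_elementary_class \<tau> K sub LS by (rule assms(2))
  show "amalgamation \<tau> K sub K" if small: "amalgamation \<tau> K sub (models_below K LS \<kappa>)"
    unfolding amalgamation_def
  proof (intro ballI impI)
    fix M\<^sub>0 M\<^sub>1 M\<^sub>2 assume M: "sub M\<^sub>0 M\<^sub>1 \<and> sub M\<^sub>0 M\<^sub>2"
    show "\<exists>N\<in>K. \<exists>f\<^sub>1 f\<^sub>2. K_embedding \<tau> sub f\<^sub>1 M\<^sub>1 N \<and> K_embedding \<tau> sub f\<^sub>2 M\<^sub>2 N \<and>
        (\<forall>x\<in>univ M\<^sub>0. f\<^sub>1 x = f\<^sub>2 x)"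
      using amalgamation_of_small[OF assms(1,3,4), where disjoint = False, simplified]
        M small[unfolded amalgamation_def] by simp
  qed
  show "joint_embedding \<tau> K sub K" if "joint_embedding \<tau> K sub (models_below K LS \<kappa>)"
    using joint_embedding_of_small[OF assms(1,3,4) that] unfolding joint_embedding_def by simp
  show "disjoint_amalgamation \<tau> K sub K" if small: "disjoint_amalgamation \<tau> K sub (models_below K LS \<kappa>)"
    unfolding disjoint_amalgamation_def
  proof (intro ballI impI)
    fix M\<^sub>0 M\<^sub>1 M\<^sub>2 assume M: "sub M\<^sub>0 M\<^sub>1 \<and> sub M\<^sub>0 M\<^sub>2"
    show "\<exists>N\<in>K. \<exists>f\<^sub>1 f\<^sub>2. K_embedding \<tau> sub f\<^sub>1 M\<^sub>1 N \<and> K_embedding \<tau> sub f\<^sub>2 M\<^sub>2 N \<and>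
        (\<forall>x\<in>univ M\<^sub>0. f\<^sub>1 x = f\<^sub>2 x) \<and> f\<^sub>1 ` univ M\<^sub>1 \<inter> f\<^sub>2 ` univ M\<^sub>2 = f\<^sub>1 ` univ M\<^sub>0"
      using amalgamation_of_small[OF assms(1,3,4), where disjoint = True, simplified]
        M small[unfolded disjoint_amalgamation_def] by simp
  qed
qed

end
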